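(* For every decimal $d\in\mathbb{R}$ there exists a permutation (i.e., a bijection) $\pi\colon X_R\to X_R$ such that the $\pi$-conjugate of the additive $d$-shift $u(x)\mapsto u(d+_Rx)$ ($x\in\mathbb{R}$) on $X_R$ is computable.
   Context: $\mathbb{N}=\{1,2,\dots\}$, $\mathbb{N}_0=\{0,1,2,\dots\}$, $D=\{0,1,\dots,9\}$. **Decimals.** A decimal is a formal infinite linear combination $d=(-)\sum_{n\le k}d_n10^n$ with an optional minus sign, $k\in\mathbb{N}_0$ (the order of $d$), $n\in\mathbb{Z}$, $d_n\in D$, such that (i) $d_k=0$ implies $k=0$; (ii) there is no $n\le k$ with $d_m=9$ for all $m\le n$; (iii) $-\sum_{n\le 0}0\cdot10^n$ is not allowed. Digits $d_n$ with $n>k$ are set to $0$. Two decimals are equal iff they have equal signs, orders and digits. $\mathbb{R}$ denotes the set of decimals. **Addition of decimals.** Let $\mathbb{Q}_D\subset\mathbb{Q}$ be the subring of fractions with a finite decimal expansion. For a decimal $d=(-)\sum_{n\le k}d_n10^n\in\mathbb{R}$ of order $k$ and $m\in\mathbb{N}$ let $r(d\,|\,m)=\pm\sum_{-m\le n\le k}d_n10^n\in\mathbb{Q}_D$ (with the sign of $d$) be the value of the $m$-th truncation of $d$. A sequence $(a_n)\subset\mathbb{Q}_D$ is Cauchy if for every $k\in\mathbb{N}$ there is $n_0\in\mathbb{N}$ with $|a_m-a_n|<1/k$ for all $m,n\ge n_0$. A Cauchy sequence $(a_n)\subset\mathbb{Q}_D$ generates $d$, written $d=G(a_n)$, if for every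 $k\in\mathbb{N}$ there is $n_0\in\mathbb{N}$ such that $|r(d\,|\,n)-a_n|<1/k$ for all $n\ge n_0$. Every decimal has a generating sequence and every Cauchy sequence in $\mathbb{Q}_D$ generates exactly one decimal. For $d=G(a_n)$, $e=G(b_n)$ one defines $d+_Re:=G(a_n+b_n)$ (independent of the choice of generating sequences). **Encodings and conjugates.** For a nonempty finite alphabet $A$ let $A^{\infty}=A^{\mathbb{N}_0}$ be the set of one-way infinite words over $A$. An encoding is a nonempty subset $X\subset A^\infty$. A unary operation on $X$ is a map $F\colon X\to X$. If $\pi\colon X\to X'$ is a bijection between encodings, the $\pi$-conjugate of $F\colon X\to X$ is the unary operation $F'\colon X'\to X'$, $F'(u)=\pi(F(\pi^{-1}(u)))$. **Canonical encoding $X_R$.** Let $A=D\cup\{-,\xi\}$, with $\xi$ a separation symbol. A decimal $d=(-)\sum_{n\le k}d_n10^n$ of order $k$ is encoded as the word $u(d)\in A^\infty$ consisting of the minus sign if $d$ has one, then the binary digits of $k$ (least significant digit first; $0$ is written as the single digit $0$), then $\xi$, then the digits $d_k,d_{k-1},d_{k-2},\dots$ in this order. $X_R=\{u(d)\mid d\in\mathbb{R}\}$. **Unary machines and computability.** A unary machine $M$ (for an encoding $X\subset A^\infty$) is a Turing machine with a finite set of states containing an initial and a terminal state, and with a finite alphabet $A'\supset A\cup\{0,1,\epsilon\}$, where $\epsilon\in A'\setminus A$ is the empty cell symbol. It operates on two bi-infinite tapes $T_1,T_2$, with cells labeled by $\mathbb{Z}$, via corresponding heads; the head on $T_1$ only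 reads, the head on $T_2$ reads and writes. An input is a pair $(x,m)\in X\times\mathbb{N}_0$: the word $x=x_0x_1\dots$ is stored on $T_1$ with $x_n$ in cell $n$ and $\epsilon$ in every cell $n<0$; $m$ is stored in binary on $T_2$ with the least significant digit in cell $0$ and successive digits in cells $1,2,\dots$, all other cells containing $\epsilon$. The computation starts in the initial state with both heads at cell $0$. In each step, if $M$ is in the terminal state the computation terminates; otherwise, depending only on the current state and the contents of the two scanned cells, $M$ rewrites the scanned cell of $T_2$, moves each head by $-1$, $0$ or $+1$, and passes to a new (possibly the same) state, according to its finite instruction table. $M$ computes $F\colon X\to X$ if for every input $(x,m)$ it terminates with $z_m$ in cell $0$ of $T_2$ and $\epsilon$ in all other cells of $T_2$, where $F(x)=z_0z_1\dots$. A unary operation $F$ is computable if some unary machine computes it. *)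

theory Defs
  imports Complex_Main "HOL-Library.FuncSet"
begin

section \<open>Decimals\<close>

text \<open>A decimal is a triple (minus sign present?, order, digits); the digits are indexed by all
  integers and vanish above the order.\<close>

typedef decimal =
  "{(s :: bool, k :: nat, f :: int \<Rightarrow> nat).
      (\<forall>n. f n \<le> 9) \<and> (\<forall>n. int k < n \<longrightarrow> f n = 0) \<and>
      (f (int k) = 0 \<longrightarrow> k = 0) \<and>
      \<not> (\<exists>n \<le> int k. \<forall>m \<le> n. f m = 9) \<and>
      \<not> (s \<and> k = 0 \<and> (\<forall>n. f n = 0))}"
  by (rule exI[of _ "(False, 0, \<lambda>_. 0)"]) auto

definition neg :: "decimal \<Rightarrow> bool"
  where "neg d = fst (Rep_decimal d)"

definition ord_dec :: "decimal \<Rightarrow> nat"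
  where "ord_dec d = fst (snd (Rep_decimal d))"

definition digit :: "decimal \<Rightarrow> int \<Rightarrow> nat"
  where "digit d = snd (snd (Rep_decimal d))"


section \<open>Addition of decimals\<close>

text \<open>Sequences are indexed by the positive integers; the value at index 0 of a function on the
  natural numbers is irrelevant throughout.\<close>

definition Q_D :: "rat set"
  where "Q_D = {of_int a / 10 ^ n | (a :: int) (n :: nat). True}"

definition trunc :: "decimal \<Rightarrow> nat \<Rightarrow> rat"
  where "trunc d m = (if neg d then - 1 else 1) *
    (\<Sum>n = - int m..int (ord_dec d). of_nat (digit d n) * 10 powi n)"

definition cauchy_QD :: "(nat \<Rightarrow> rat) \<Rightarrow> bool"
  where "cauchy_QD a \<longleftrightarrow> (\<forall>n\<ge>1. a n \<in> Q_D) \<and>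
    (\<forall>k\<ge>1. \<exists>n0\<ge>1. \<forall>m\<ge>n0. \<forall>n\<ge>n0. \<bar>a m - a n\<bar> < 1 / of_nat k)"

definition generates :: "(nat \<Rightarrow> rat) \<Rightarrow> decimal \<Rightarrow> bool"
  where "generates a d \<longleftrightarrow> cauchy_QD a \<and>
    (\<forall>k\<ge>1. \<exists>n0\<ge>1. \<forall>n\<ge>n0. \<bar>trunc d n - a n\<bar> < 1 / of_nat k)"

definition G :: "(nat \<Rightarrow> rat) \<Rightarrow> decimal"
  where "G a = (THE d. generates a d)"

definition add_R :: "decimal \<Rightarrow> decimal \<Rightarrow> decimal"  (infixl "+\<^sub>R" 65)
  where "d +\<^sub>R e =
    (THE x. \<exists>a b. generates a d \<and> generates b e \<and> x = G (\<lambda>n. a n + b n))"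


section \<open>Words, encodings and conjugates\<close>

text \<open>One universe of symbols from which all alphabets are taken as finite subsets.
  The constructor \<open>Aux\<close> supplies arbitrarily many further tape symbols for machines.\<close>

datatype sym = Dig nat | Minus | Sep | Blank | Aux nat

type_synonym word = "nat \<Rightarrow> sym"

definition encoding :: "sym set \<Rightarrow> word set \<Rightarrow> bool"
  where "encoding A X \<longleftrightarrow>
    finite A \<and> A \<noteq> {} \<and> X \<noteq> {} \<and> (\<forall>w\<in>X. \<forall>n. w n \<in> A)"

definition conjugate :: "word set \<Rightarrow> (word \<Rightarrow> word) \<Rightarrow> (word \<Rightarrow> word) \<Rightarrow> word \<Rightarrow> word"
  where "conjugate X \<pi> F u = \<pi> (F (inv_into X \<pi> u))"


section \<open>The canonical encoding\<close>

text \<open>Least significant digit first; 0 is the single digit 0.\<close>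

fun bin_digits :: "nat \<Rightarrow> nat list"
  where "bin_digits n = (if n < 2 then [n] else (n mod 2) # bin_digits (n div 2))"

declare bin_digits.simps [simp del]

definition A_R :: "sym set"
  where "A_R = Dig ` {0..9} \<union> {Minus, Sep}"

definition enc_prefix :: "decimal \<Rightarrow> sym list"
  where "enc_prefix d =
    (if neg d then [Minus] else []) @ map Dig (bin_digits (ord_dec d)) @ [Sep]"

definition enc :: "decimal \<Rightarrow> word"
  where "enc d i =
    (let p = enc_prefix d in
     if i < length p then p ! i
     else Dig (digit d (int (ord_dec d) - int (i - length p))))"

definition X_R :: "word set"
  where "X_R = range enc"

text \<open>The following two facts confirm that \<open>inv enc\<close> below is the inverse of a bijection onto
  \<open>X_R\<close> and that \<open>X_R\<close> is an encoding.\<close>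

lemma bin_digits_inj: "bin_digits m = bin_digits n \<Longrightarrow> m = n"
proof -
  have "foldr (\<lambda>b s. b + 2 * s) (bin_digits n) 0 = n" for n
  proof (induction n rule: bin_digits.induct)
    case (1 n)
    then show ?case by (subst bin_digits.simps) auto
  qed
  then show "bin_digits m = bin_digits n \<Longrightarrow> m = n" by metis
qed

lemma bin_digits_le_1: "b \<in> set (bin_digits n) \<Longrightarrow> b \<le> 1"
proof (induction n rule: bin_digits.induct)
  case (1 n)
  then show ?case by (subst (asm) (2) bin_digits.simps) (auto split: if_splits)
qed

lemma digit_le_9: "digit d n \<le> 9"
  using Rep_decimal[of d] by (auto simp: digit_def split: prod.splits)

lemma digit_above_order: "int (ord_dec d) < n \<Longrightarrow> digit d n = 0"
  using Rep_decimal[of d] by (auto simp: digit_def ord_dec_def split: prod.splits)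

lemma decimal_eqI: "neg d = neg e \<Longrightarrow> ord_dec d = ord_dec e \<Longrightarrow> digit d = digit e \<Longrightarrow> d = e"
  by (simp add: neg_def ord_dec_def digit_def prod_eq_iff Rep_decimal_inject[symmetric])

lemma enc_less: "i < length (enc_prefix d) \<Longrightarrow> enc d i = enc_prefix d ! i"
  by (simp add: enc_def)

lemma enc_prefix_plus:
  "enc d (length (enc_prefix d) + j) = Dig (digit d (int (ord_dec d) - int j))"
  by (simp add: enc_def)

lemma inj_enc: "inj enc"
proof (rule injI)
  fix d e assume eq: "enc d = enc e"
  have sep: "enc d i = Sep \<longleftrightarrow> i = length (enc_prefix d) - 1" for d i
  proof -
    have "xs ! j \<noteq> Sep" if "j < length xs" "xs = (if neg d then [Minus] else []) @
      map Dig (bin_digits (ord_dec d))" for xs j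
      using nth_mem[OF that(1)] that(2) by (auto split: if_splits)
    then show ?thesis
      by (auto simp: enc_def enc_prefix_def nth_append Let_def)
  qed
  have pos: "length (enc_prefix d) > 0" for d
    by (simp add: enc_prefix_def)
  have len: "length (enc_prefix d) = length (enc_prefix e)"
    using sep[of d] sep[of e] eq pos[of d] pos[of e]
    by (metis One_nat_def Suc_pred)
  have pre: "enc_prefix d = enc_prefix e"
    by (rule nth_equalityI) (use len eq in \<open>auto simp: enc_less[symmetric]\<close>)
  have inj_Dig: "inj Dig" by (simp add: inj_def)
  have "neg d = neg e \<and> bin_digits (ord_dec d) = bin_digits (ord_dec e)"
    using pre inj_map_eq_map[OF inj_Dig]
    by (cases "bin_digits (ord_dec d)"; cases "bin_digits (ord_dec e)")
       (auto simp: enc_prefix_def split: if_splits)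
  then have 1: "neg d = neg e" "ord_dec d = ord_dec e"
    using bin_digits_inj by blast+
  have "digit d (int (ord_dec d) - int j) = digit e (int (ord_dec d) - int j)" for j
    using enc_prefix_plus[of d j] enc_prefix_plus[of e j] eq len 1 by simp
  then have "digit d n = digit e n" for n
    using digit_above_order[of d n] digit_above_order[of e n] 1
    by (cases "n \<le> int (ord_dec d)") (metis int_nat_eq diff_ge_0_iff_ge diff_diff_eq2 add_diff_cancel_left', auto)
  then show "d = e" using 1 by (auto intro: decimal_eqI)
qed

lemma encoding_X_R: "encoding A_R X_R"
proof -
  have "set (enc_prefix d) \<subseteq> A_R" for d
    using bin_digits_le_1[of _ "ord_dec d"] by (fastforce simp: enc_prefix_def A_R_def)
  then have "enc_prefix d ! n \<in> A_R" if "n < length (enc_prefix d)" for d n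
    using nth_mem[OF that] by blast
  moreover have "Dig (digit d n) \<in> A_R" for d n
    using digit_le_9[of d n] by (simp add: A_R_def)
  ultimately have "enc d n \<in> A_R" for d n
    by (simp add: enc_def Let_def)
  then show ?thesis
    by (auto simp: encoding_def X_R_def) (simp_all add: A_R_def)
qed

definition add_shift :: "decimal \<Rightarrow> word \<Rightarrow> word"
  where "add_shift d w = enc (d +\<^sub>R inv enc w)"


section \<open>Unary machines\<close>

text \<open>An instruction consists of the symbol written to the second tape, the moves of the two
  heads and the new state.\<close>

record machine =
  states :: "nat set"
  init :: nat
  final :: nat
  tape_alph :: "sym set"
  instr :: "nat \<Rightarrow> sym \<Rightarrow> sym \<Rightarrow> sym \<times> int \<times> int \<times> nat"

definition unary_machine :: "sym set \<Rightarrow> machine \<Rightarrow> bool"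
  where "unary_machine A M \<longleftrightarrow>
    finite (states M) \<and> init M \<in> states M \<and> final M \<in> states M \<and>
    finite (tape_alph M) \<and> A \<union> {Dig 0, Dig 1, Blank} \<subseteq> tape_alph M \<and> Blank \<notin> A \<and>
    (\<forall>q \<in> states M - {final M}. \<forall>a \<in> tape_alph M. \<forall>b \<in> tape_alph M.
       instr M q a b \<in> tape_alph M \<times> {-1, 0, 1} \<times> {-1, 0, 1} \<times> states M)"

record config =
  state :: nat
  head1 :: int
  head2 :: int
  tape2 :: "int \<Rightarrow> sym"

definition tape1 :: "word \<Rightarrow> int \<Rightarrow> sym"
  where "tape1 x i = (if 0 \<le> i then x (nat i) else Blank)"

definition start :: "machine \<Rightarrow> nat \<Rightarrow> config"
  where "start M m =
    \<lparr>state = init M, head1 = 0, head2 = 0,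
     tape2 = (\<lambda>i. if 0 \<le> i \<and> nat i < length (bin_digits m)
                  then Dig (bin_digits m ! nat i) else Blank)\<rparr>"

text \<open>Terminal configurations are fixed points.\<close>

definition step :: "machine \<Rightarrow> word \<Rightarrow> config \<Rightarrow> config"
  where "step M x c =
    (if state c = final M then c
     else case instr M (state c) (tape1 x (head1 c)) (tape2 c (head2 c)) of
       (b, i, j, q) \<Rightarrow>
         \<lparr>state = q, head1 = head1 c + i, head2 = head2 c + j,
          tape2 = (tape2 c)(head2 c := b)\<rparr>)"

definition computes :: "machine \<Rightarrow> word set \<Rightarrow> (word \<Rightarrow> word) \<Rightarrow> bool"
  where "computes M X F \<longleftrightarrow>
    (\<forall>x\<in>X. \<forall>m. \<exists>t. state ((step M x ^^ t) (start M m)) = final M \<and>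
       tape2 ((step M x ^^ t) (start M m)) = (\<lambda>_. Blank)(0 := F x m))"

text \<open>For a map \<open>F\<close> on words that is a unary operation on the encoding \<open>X\<close> over \<open>A\<close>;
  values of \<open>F\<close> outside \<open>X\<close> are irrelevant.\<close>

definition computable :: "sym set \<Rightarrow> word set \<Rightarrow> (word \<Rightarrow> word) \<Rightarrow> bool"
  where "computable A X F \<longleftrightarrow>
    encoding A X \<and> F \<in> X \<rightarrow> X \<and> (\<exists>M. unary_machine A M \<and> computes M X F)"

end

theory Submission
  imports Defs "HOL-Library.Countable"
begin

text \<open>
  The proof rests on the fact that conjugation sees nothing of a permutation except the number and
  the lengths of its cycles, whereas computability depends on the permutation itself. So
  it suffices to find \<^emph>\<open>some\<close> computable permutation of the encoding that has the same cycles as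
  the shift by \<open>d\<close>.

  If \<open>d\<close> is zero, the shift is the identity. Otherwise decimals with \<open>+\<^sub>R\<close> behave like the real
  numbers (\<open>bij_val\<close>, \<open>val_add_R\<close>), so the shift has no finite cycle, and it has infinitely many
  orbits because the fractional part of \<open>x / d\<close> is constant on each of them and
  takes infinitely many values. For any such free
  permutation of a set \<open>X\<close>, a transversal \<open>T\<close> of the orbits satisfies \<open>|X| = |\<int> \<times> T| = |T|\<close>;
  hence the permutation is a copy of \<open>(z, a) \<mapsto> (z + 1, a)\<close> on \<open>\<int> \<times> X\<close>, and any two free
  permutations of \<open>X\<close> with infinitely many orbits are conjugate (\<open>free_permutations_conjugate\<close>).

  The computable partner of the shift is an adding machine on the digit string of a decimal. It
  leaves the sign, the order and an initial piece of the digits alone, and from there on increases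
  digits cyclically, moving to the next digit exactly when the digit just treated was 0. Unlike
  in ordinary addition, where the carry turns a string of 9s into a string of 0s, the
  carry here turns \<open>000\<dots>\<close> into \<open>111\<dots>\<close>; every other digit string is changed in finitely many
  places only. Thus the forbidden tails of 9s neither arise nor are missed. The digits
  left alone are the leading one for a decimal without sign, and those up to the first
  nonzero one for a negative decimal; this keeps the leading digit admissible and excludes minus
  zero. The map is a permutation (\<open>bij_odometer\<close>), it has no finite cycle because it adds 1
  modulo every power of 10 (\<open>free_odometer\<close>), and it has infinitely many orbits because it
  preserves the order.

  Finally, the adding machine reads its input from left to right with finite memory: it is a
  letter-to-letter transducer. A unary machine can run any such transducer along the first tape
  while counting the given index down to zero on the second one
  (\<open>computes_counter_machine\<close>).
\<close>

section \<open>Conjugacy of free permutations\<close>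

definition zpow :: "('a \<Rightarrow> 'a) \<Rightarrow> int \<Rightarrow> 'a \<Rightarrow> 'a"
  where "zpow f z = (if 0 \<le> z then f ^^ nat z else inv f ^^ nat (- z))"

lemma zpow_0 [simp]: "zpow f 0 x = x"
  by (simp add: zpow_def)

lemma zpow_plus_1:
  assumes "bij f"
  shows "zpow f (z + 1) x = f (zpow f z x)"
proof (cases "0 \<le> z")
  case True
  then show ?thesis by (simp add: zpow_def nat_add_distrib)
next
  case False
  then have "nat (- z) = Suc (nat (- (z + 1)))" by simp
  then have "f (zpow f z x) = (inv f ^^ nat (- (z + 1))) x"
    using False assms by (simp add: zpow_def bij_is_surj surj_f_inv_f)
  then show ?thesis using False by (cases "z = - 1") (auto simp: zpow_def)
qed

lemma zpow_add:
  assumes "bij f"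
  shows "zpow f (a + b) x = zpow f a (zpow f b x)"
proof (induction a rule: int_induct[where k = 0])
  case base
  then show ?case by simp
next
  case (step1 i)
  then show ?case
    using zpow_plus_1[OF assms, of "i + b" x] zpow_plus_1[OF assms, of i]
    by (simp add: algebra_simps)
next
  case (step2 i)
  then have "f (zpow f (i - 1 + b) x) = f (zpow f (i - 1) (zpow f b x))"
    using zpow_plus_1[OF assms, of "i - 1 + b" x] zpow_plus_1[OF assms, of "i - 1"]
    by (simp add: algebra_simps)
  then show ?case using assms by (simp add: bij_is_inj inj_eq)
qed

text \<open>A permutation with this property has only infinite cycles.\<close>

definition free_map :: "('a \<Rightarrow> 'a) \<Rightarrow> bool"
  where "free_map f \<longleftrightarrow> (\<forall>n>0. \<forall>x. (f ^^ n) x \<noteq> x)"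

lemma zpow_free:
  assumes "bij f" "free_map f" "zpow f a x = zpow f b x"
  shows "a = b"
proof -
  have le: "a = b" if "zpow f a x = zpow f b x" "a \<le> b" for a b
  proof -
    have "(f ^^ nat (b - a)) (zpow f a x) = zpow f (b - a + a) x"
      using that(2) by (subst zpow_add[OF assms(1)]) (simp add: zpow_def)
    then have "\<not> 0 < nat (b - a)"
      using assms(2) that(1) by (auto simp: free_map_def)
    then show ?thesis using that(2) by simp
  qed
  show ?thesis using le[of a b] le[of b a] assms(3) by (cases "a \<le> b") auto
qed

text \<open>The invariant \<open>I\<close> is a convenient certificate for infinitely many orbits. Since the transversal
  \<open>T\<close> is then infinite, multiplying its cardinality by \<open>\<aleph>\<^sub>0\<close> does not change it, so the whole type can serve as index set
  of the orbits.\<close>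

lemma free_permutation_shift:
  includes cardinal_syntax
  fixes f :: "'a \<Rightarrow> 'a" and I :: "'a \<Rightarrow> 'b"
  assumes bij: "bij f" and free: "free_map f"
    and inv: "\<And>x. I (f x) = I x" and inf: "infinite (range I)"
  obtains \<phi> :: "int \<times> 'a \<Rightarrow> 'a"
  where "bij \<phi>" "\<And>z a. \<phi> (z + 1, a) = f (\<phi> (z, a))"
proof -
  define orb where "orb x = range (\<lambda>z. zpow f z x)" for x
  define rep where "rep x = (SOME y. y \<in> orb x)" for x
  define T where "T = range rep"
  have orb_self: "x \<in> orb x" for x
    unfolding orb_def by (rule range_eqI[of _ _ 0]) simp
  have orb_zpow: "orb (zpow f z x) = orb x" for z :: int and x
  proof (intro equalityI subsetI)
    fix y assume "y \<in> orb (zpow f z x)"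
    then show "y \<in> orb x" by (auto simp: orb_def zpow_add[OF bij, symmetric])
  next
    fix y assume "y \<in> orb x"
    then obtain w where "y = zpow f w x" by (auto simp: orb_def)
    then have "y = zpow f (w - z) (zpow f z x)" by (simp add: zpow_add[OF bij, symmetric])
    then show "y \<in> orb (zpow f z x)" by (simp add: orb_def)
  qed
  have rep_in: "rep x \<in> orb x" for x
    unfolding rep_def using orb_self by (rule someI)
  have rep_zpow: "rep (zpow f z x) = rep x" for z :: int and x
    by (simp add: rep_def orb_zpow)
  \<comment> \<open>each orbit meets \<open>T\<close> in exactly one point\<close>
  have rep_T: "rep t = t" if t: "t \<in> T" for t
  proof -
    obtain x where x: "t = rep x" using t by (auto simp: T_def)
    obtain z where "rep x = zpow f z x" using rep_in[of x] by (auto simp: orb_def)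
    then show ?thesis using x rep_zpow[of z x] by simp
  qed
  have I_zpow: "I (zpow f z x) = I x" for z :: int and x
  proof (induction z rule: int_induct[where k = 0])
    case (step2 i)
    then show ?case using zpow_plus_1[OF bij, of "i - 1" x] inv[of "zpow f (i - 1) x"] by simp
  qed (simp_all add: zpow_plus_1[OF bij] inv)
  have "I x \<in> I ` T" for x
  proof -
    obtain z where "rep x = zpow f z x" using rep_in[of x] by (auto simp: orb_def)
    then have "I x = I (rep x)" by (simp add: I_zpow)
    then show ?thesis by (auto simp: T_def)
  qed
  then have "range I \<subseteq> I ` T" by auto
  then have inf_T: "infinite T" using inf finite_subset by blast
  have bij_T: "bij_betw (\<lambda>(z, t). zpow f z t) (UNIV \<times> T) UNIV"
  proof (rule bij_betwI')
    fix p q :: "int \<times> 'a" assume pq: "p \<in> UNIV \<times> T" "q \<in> UNIV \<times> T"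
    obtain z t w s where [simp]: "p = (z, t)" "q = (w, s)" by (cases p, cases q)
    have "t = s" if "zpow f z t = zpow f w s"
      using pq rep_zpow[of z t] rep_zpow[of w s] rep_T that by auto
    then show "(case p of (z, t) \<Rightarrow> zpow f z t) = (case q of (z, t) \<Rightarrow> zpow f z t) \<longleftrightarrow> p = q"
      using zpow_free[OF bij free, of z s w] by auto
  next
    fix x
    obtain z where z: "rep x = zpow f z x" using rep_in[of x] by (auto simp: orb_def)
    then have "x = zpow f (- z) (rep x)" by (simp add: zpow_add[OF bij, symmetric])
    then show "\<exists>p\<in>UNIV \<times> T. x = (case p of (z, t) \<Rightarrow> zpow f z t)"
      by (intro bexI[of _ "(- z, rep x)"]) (auto simp: T_def)
  qed auto
  have "|UNIV :: int set| \<le>o |UNIV :: nat set|"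
    by (rule card_of_ordLeqI[of to_nat]) auto
  then have "|UNIV :: int set| \<le>o |T|"
    using inf_T infinite_iff_card_of_nat ordLeq_transitive by blast
  then have "|T \<times> (UNIV :: int set)| =o |T|"
    using inf_T by (intro card_of_Times_infinite[THEN conjunct1]) auto
  moreover have "|(UNIV :: int set) \<times> T| =o |UNIV :: 'a set|"
    using bij_T by (rule card_of_ordIsoI)
  then have "|T \<times> (UNIV :: int set)| =o |UNIV :: 'a set|"
    using card_of_Times_commute ordIso_transitive by blast
  ultimately have "|UNIV :: 'a set| =o |T|"
    by (meson ordIso_symmetric ordIso_transitive)
  then obtain h where h: "bij_betw h (UNIV :: 'a set) T"
    using card_of_ordIso by blast
  have "bij_betw (map_prod id h) (UNIV \<times> UNIV) (UNIV \<times> T)"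
    by (rule bij_betw_map_prod) (auto simp: h)
  then have "bij ((\<lambda>(z, t). zpow f z t) \<circ> map_prod id h)"
    using bij_betw_trans[OF _ bij_T] by auto
  then show thesis
    by (rule that) (simp add: zpow_plus_1[OF bij])
qed

lemma free_permutations_conjugate:
  fixes f g :: "'a \<Rightarrow> 'a" and I :: "'a \<Rightarrow> 'b" and J :: "'a \<Rightarrow> 'c"
  assumes "bij f" "free_map f" "\<And>x. I (f x) = I x" "infinite (range I)"
    and "bij g" "free_map g" "\<And>x. J (g x) = J x" "infinite (range J)"
  obtains \<pi> where "bij \<pi>" "\<And>x. \<pi> (f x) = g (\<pi> x)"
proof -
  obtain \<phi> :: "int \<times> 'a \<Rightarrow> 'a" where \<phi>: "bij \<phi>" "\<And>z a. \<phi> (z + 1, a) = f (\<phi> (z, a))"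
    using free_permutation_shift[OF assms(1-4)] by metis
  obtain \<psi> :: "int \<times> 'a \<Rightarrow> 'a" where \<psi>: "bij \<psi>" "\<And>z a. \<psi> (z + 1, a) = g (\<psi> (z, a))"
    using free_permutation_shift[OF assms(5-8)] by metis
  show thesis
  proof
    show "bij (\<psi> \<circ> inv \<phi>)"
      using \<phi>(1) \<psi>(1) by (simp add: bij_comp bij_imp_bij_inv)
    show "(\<psi> \<circ> inv \<phi>) (f x) = g ((\<psi> \<circ> inv \<phi>) x)" for x
    proof -
      obtain z a where x: "x = \<phi> (z, a)"
        using \<phi>(1) by (metis bij_is_surj surj_def surj_pair)
      then have "f x = \<phi> (z + 1, a)" by (simp add: \<phi>(2))
      then show ?thesis
        using x \<phi>(1) \<psi>(2) by (simp add: bij_is_inj inv_f_f)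
    qed
  qed
qed

section \<open>Decimals as real numbers\<close>

text \<open>The integer part of the modulus of \<open>d\<close> divided by \<open>10 ^ n\<close>, for \<open>n\<close> of either sign. Its last digit
  is the digit of \<open>d\<close> at \<open>n\<close>, which turns questions about digits into questions about floors.\<close>

definition mag :: "decimal \<Rightarrow> int \<Rightarrow> nat"
  where "mag d n = (\<Sum>i = n..int (ord_dec d). digit d i * 10 ^ nat (i - n))"

lemma mag_above: "int (ord_dec d) < n \<Longrightarrow> mag d n = 0"
  by (simp add: mag_def)

lemma mag_rec: "mag d n = digit d n + 10 * mag d (n + 1)"
proof (cases "n \<le> int (ord_dec d)")
  case True
  have "mag d n = digit d n + (\<Sum>i = n + 1..int (ord_dec d). digit d i * 10 ^ nat (i - n))"
  proof -
    have "{n..int (ord_dec d)} = insert n {n + 1..int (ord_dec d)}" using True by auto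
    then show ?thesis by (simp add: mag_def)
  qed
  also have "(\<Sum>i = n + 1..int (ord_dec d). digit d i * 10 ^ nat (i - n)) = 10 * mag d (n + 1)"
    unfolding mag_def sum_distrib_left
  proof (rule sum.cong)
    fix i assume "i \<in> {n + 1..int (ord_dec d)}"
    then have "nat (i - n) = Suc (nat (i - (n + 1)))" by auto
    then show "digit d i * 10 ^ nat (i - n) = 10 * (digit d i * 10 ^ nat (i - (n + 1)))" by simp
  qed simp
  finally show ?thesis .
next
  case False
  then show ?thesis by (simp add: mag_above digit_above_order)
qed

lemma mag_mod: "mag d n mod 10 = digit d n" and mag_div: "mag d n div 10 = mag d (n + 1)"
  using mag_rec[of d n] digit_le_9[of d n] by simp_all

lemma of_rat_power_int: "real_of_rat (10 powi n) = 10 powi n"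
  by (simp add: power_int_def of_rat_power of_rat_divide)

lemma real_trunc:
  "real_of_rat (trunc d m) = (if neg d then - 1 else 1) * (real (mag d (- int m)) / 10 ^ m)"
proof -
  have "(\<Sum>n = - int m..int (ord_dec d). real (digit d n) * 10 powi n) =
    real (mag d (- int m)) / 10 ^ m"
    unfolding mag_def of_nat_sum sum_divide_distrib
  proof (rule sum.cong)
    fix i assume "i \<in> {- int m..int (ord_dec d)}"
    then have "i = int (nat (i + int m)) - int m" "nat (i - - int m) = nat (i + int m)" by auto
    then have "(10::real) powi i = 10 ^ nat (i - - int m) / 10 ^ m"
      by (metis power_int_diff power_int_of_nat zero_neq_numeral)
    then show "real (digit d i) * 10 powi i = real (digit d i * 10 ^ nat (i - - int m)) / 10 ^ m"
      by simp
  qed simp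
  then show ?thesis
    by (simp add: trunc_def of_rat_mult of_rat_sum of_rat_power_int of_rat_minus)
qed

definition abs_val :: "decimal \<Rightarrow> real"
  where "abs_val d = lim (\<lambda>m. real (mag d (- int m)) / 10 ^ m)"

definition val :: "decimal \<Rightarrow> real"
  where "val d = (if neg d then - 1 else 1) * abs_val d"

lemma mag_Suc: "mag d (- int (Suc m)) = digit d (- int (Suc m)) + 10 * mag d (- int m)"
  using mag_rec[of d "- int (Suc m)"] by simp

lemma lower_incseq: "incseq (\<lambda>m. real (mag d (- int m)) / 10 ^ m)"
  by (rule incseq_SucI) (simp add: mag_Suc divide_simps del: of_nat_Suc)

text \<open>Together with \<open>lower_incseq\<close> this encloses the modulus of a decimal in nested intervals of length
  \<open>1 / 10 ^ m\<close>.\<close>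

lemma upper_decseq: "decseq (\<lambda>m. (real (mag d (- int m)) + 1) / 10 ^ m)"
proof (rule decseq_SucI)
  fix m
  have "real (digit d (- int (Suc m))) \<le> 9"
    using digit_le_9[of d "- int (Suc m)"] by linarith
  then show "(real (mag d (- int (Suc m))) + 1) / 10 ^ Suc m \<le> (real (mag d (- int m)) + 1) / 10 ^ m"
    unfolding mag_Suc by (simp add: field_simps)
qed

lemma abs_val_limit: "(\<lambda>m. real (mag d (- int m)) / 10 ^ m) \<longlonglongrightarrow> abs_val d"
proof -
  have "real (mag d (- int m)) / 10 ^ m \<le> (real (mag d (- int 0)) + 1) / 10 ^ 0" for m
  proof -
    have "real (mag d (- int m)) / 10 ^ m \<le> (real (mag d (- int m)) + 1) / 10 ^ m"
      by (simp add: divide_simps)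
    also have "\<dots> \<le> (real (mag d (- int 0)) + 1) / 10 ^ 0"
      using upper_decseq[of d, THEN decseqD, of 0 m] by simp
    finally show ?thesis .
  qed
  then have "convergent (\<lambda>m. real (mag d (- int m)) / 10 ^ m)"
    using incseq_convergent[OF lower_incseq] unfolding convergent_def by metis
  then show ?thesis
    unfolding abs_val_def by (simp add: convergent_LIMSEQ_iff)
qed

lemma ten_power_inverse_limit: "(\<lambda>m. 1 / (10::real) ^ m) \<longlonglongrightarrow> 0"
  using LIMSEQ_power_zero[of "1 / 10 :: real"] by (simp add: power_one_over)

lemma abs_val_lower: "real (mag d (- int m)) / 10 ^ m \<le> abs_val d"
  using incseq_le[OF lower_incseq abs_val_limit] .

lemma abs_val_upper_weak: "abs_val d \<le> (real (mag d (- int m)) + 1) / 10 ^ m"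
proof (rule decseq_ge[OF upper_decseq])
  show "(\<lambda>m. (real (mag d (- int m)) + 1) / 10 ^ m) \<longlonglongrightarrow> abs_val d"
    using tendsto_add[OF abs_val_limit[of d] ten_power_inverse_limit] by (simp add: add_divide_distrib)
qed

lemma no_tail_of_9: "\<exists>m \<le> n. digit d m \<noteq> 9"
proof -
  have "\<forall>i \<le> int (ord_dec d). \<exists>m \<le> i. digit d m \<noteq> 9"
    using Rep_decimal[of d] by (auto simp: digit_def ord_dec_def split: prod.splits)
  then obtain m where "m \<le> min n (int (ord_dec d))" "digit d m \<noteq> 9"
    using min.cobounded2 by blast
  then show ?thesis by auto
qed

text \<open>Strictness is where the absence of a tail of 9s enters: a digit other than 9 makes the upper
  bounds drop strictly. It is what makes the decimal expansion of a real number unique.\<close>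

lemma abs_val_upper: "abs_val d < (real (mag d (- int m)) + 1) / 10 ^ m"
proof -
  obtain i where i: "i \<le> - int (Suc m)" "digit d i \<noteq> 9"
    using no_tail_of_9 by blast
  define p where "p = nat (- i) - 1"
  have p: "i = - int (Suc p)" "m \<le> p" using i(1) by (auto simp: p_def)
  have "real (digit d (- int (Suc p))) < 9"
    using digit_le_9[of d i] i(2) p(1) by auto
  then have "(real (mag d (- int (Suc p))) + 1) / 10 ^ Suc p < (real (mag d (- int p)) + 1) / 10 ^ p"
    unfolding mag_Suc by (simp add: field_simps)
  also have "\<dots> \<le> (real (mag d (- int m)) + 1) / 10 ^ m"
    using decseqD[OF upper_decseq p(2)] .
  finally show ?thesis using abs_val_upper_weak[of d "Suc p"] by linarith
qed

lemma floor_abs_val: "\<lfloor>abs_val d * 10 ^ m\<rfloor> = int (mag d (- int m))"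
  using abs_val_lower[of d m] abs_val_upper[of d m] by (intro floor_unique) (simp_all add: field_simps)

lemma abs_val_nonneg: "0 \<le> abs_val d"
  using abs_val_lower[of d 0] by (meson divide_nonneg_nonneg of_nat_0_le_iff order_trans zero_le_numeral zero_le_power)

lemma ord_dec_le:
  assumes "\<And>n. int k < n \<Longrightarrow> digit d n = 0"
  shows "ord_dec d \<le> k"
proof -
  have "digit d (int (ord_dec d)) = 0 \<Longrightarrow> ord_dec d = 0"
    using Rep_decimal[of d] by (auto simp: digit_def ord_dec_def split: prod.splits)
  then show ?thesis using assms[of "int (ord_dec d)"] by force
qed

lemma not_neg_zero: "neg d \<Longrightarrow> \<exists>n. digit d n \<noteq> 0"
proof (rule ccontr)
  assume "neg d" and *: "\<nexists>n. digit d n \<noteq> 0"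
  then have "ord_dec d = 0" using ord_dec_le[of 0 d] by auto
  then show False
    using Rep_decimal[of d] \<open>neg d\<close> * by (auto simp: digit_def ord_dec_def neg_def split: prod.splits)
qed

lemma val_limit: "(\<lambda>m. real_of_rat (trunc d m)) \<longlonglongrightarrow> val d"
  unfolding real_trunc val_def by (intro tendsto_mult tendsto_const abs_val_limit)

lemma abs_val_inject:
  assumes "abs_val d = abs_val e"
  shows "digit d = digit e"
proof -
  have neg: "mag d (- int m) = mag e (- int m)" for m
    using floor_abs_val[of d m] floor_abs_val[of e m] assms by simp
  have pos: "mag d (int m) = mag e (int m)" for m
  proof (induction m)
    case 0
    then show ?case using neg[of 0] by simp
  next
    case (Suc m)
    then show ?case using mag_div[of d "int m"] mag_div[of e "int m"] by (simp add: add.commute)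
  qed
  have "mag d n = mag e n" for n
    using neg pos by (cases n rule: int_cases2) auto
  then show ?thesis by (metis mag_mod ext)
qed

lemma abs_val_pos_iff: "0 < abs_val d \<longleftrightarrow> (\<exists>n. digit d n \<noteq> 0)"
proof
  assume "0 < abs_val d"
  show "\<exists>n. digit d n \<noteq> 0"
  proof (rule ccontr)
    assume "\<nexists>n. digit d n \<noteq> 0"
    then have "(\<lambda>m::nat. 0) \<longlonglongrightarrow> abs_val d"
      using abs_val_limit[of d] by (simp add: mag_def)
    then show False using \<open>0 < abs_val d\<close> by (simp add: LIMSEQ_const_iff)
  qed
next
  assume "\<exists>n. digit d n \<noteq> 0"
  then obtain n where n: "digit d n \<noteq> 0" ..
  have "0 < mag d (n - int j)" for j
  proof (induction j)
    case 0
    then show ?case using mag_mod[of d n] n by (cases "mag d n = 0") auto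
  next
    case (Suc j)
    then show ?case using mag_rec[of d "n - int (Suc j)"] by simp
  qed
  from this[of "nat (n + int (nat \<bar>n\<bar>))"] have "0 < mag d (- int (nat \<bar>n\<bar>))"
    by (simp add: abs_if split: if_splits)
  then have "0 < real (mag d (- int (nat \<bar>n\<bar>))) / 10 ^ nat \<bar>n\<bar>" by simp
  then show "0 < abs_val d" using abs_val_lower[of d "nat \<bar>n\<bar>"] by linarith
qed

text \<open>The value determines the modulus, the modulus determines all floors and hence all digits, the
  digits determine the order as the position of the leading one, and the exclusion of minus zero
  makes the sign of the value the sign of the decimal.\<close>

lemma inj_val: "inj val"
proof (rule injI)
  fix d e assume eq: "val d = val e"
  have "\<bar>val d\<bar> = abs_val d" for d
    using abs_val_nonneg[of d] by (simp add: val_def)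
  then have "abs_val d = abs_val e" using eq by metis
  then have dig: "digit d = digit e" by (rule abs_val_inject)
  have "neg d \<longleftrightarrow> val d < 0" for d
    using not_neg_zero[of d] abs_val_pos_iff[of d] abs_val_nonneg[of d] by (auto simp: val_def)
  then have "neg d = neg e" using eq by simp
  moreover have "ord_dec d = ord_dec e"
    using ord_dec_le[of "ord_dec e" d] ord_dec_le[of "ord_dec d" e]
      digit_above_order[of d] digit_above_order[of e] dig by force
  ultimately show "d = e" using dig by (intro decimal_eqI)
qed

text \<open>The expansion of \<open>u\<close> is read off from the floors of \<open>u / 10 ^ n\<close>. A tail of 9s
  cannot occur, since it would push \<open>u * 10 ^ p\<close> up to its floor plus 1.\<close>

lemma ex_decimal_of_sign_and_modulus:
  assumes u: "0 \<le> u" and s: "s \<Longrightarrow> 0 < u"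
  shows "\<exists>d. neg d = s \<and> abs_val d = u"
proof -
  define F where "F n = nat \<lfloor>u * 10 powi (- n)\<rfloor>" for n :: int
  have F_neg: "F (- int m) = nat \<lfloor>u * 10 ^ m\<rfloor>" for m by (simp add: F_def)
  have F_div: "F n div 10 = F (n + 1)" for n
  proof -
    have "u * 10 powi (- (n + 1)) = u * 10 powi (- n) / real_of_int 10"
      using power_int_diff[of "10::real" "- n" 1] by simp
    then have "\<lfloor>u * 10 powi (- (n + 1))\<rfloor> = \<lfloor>u * 10 powi (- n)\<rfloor> div 10"
      by (metis floor_divide_real_eq_div zero_le_numeral)
    then show ?thesis unfolding F_def by (simp add: nat_div_distrib u)
  qed
  define f where "f n = F n mod 10" for n
  have F_rec: "F n = f n + 10 * F (n + 1)" for n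
    unfolding f_def F_div[symmetric] by simp
  obtain K where K: "u < 10 ^ K"
    using real_arch_pow[of 10 u] by auto
  have F_large: "F (int n) = 0" if "K \<le> n" for n
  proof -
    have "u < 10 ^ n"
      using K power_increasing[OF that, of "10::real"] by linarith
    then have "u * 10 powi (- int n) < 1"
      by (simp add: power_int_minus field_simps)
    then show ?thesis using u by (simp add: F_def floor_eq_iff)
  qed
  define k where "k = (LEAST k. \<forall>n>k. F (int n) = 0)"
  have k0: "\<forall>n>k. F (int n) = 0"
    unfolding k_def by (rule LeastI[of _ K]) (simp add: F_large)
  have k: "F n = 0" if "int k < n" for n
    using k0[rule_format, of "nat n"] that by simp
  \<comment> \<open>a zero leading digit would make \<open>k - 1\<close> an admissible choice in the definition of \<open>k\<close>\<close>
  have lead: "k = 0" if "f (int k) = 0"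
  proof (rule ccontr)
    assume "k \<noteq> 0"
    have "F (int k) = 0" using F_rec[of "int k"] that k[of "int k + 1"] by simp
    then have "F (int n) = 0" if "n > k - 1" for n
      using k0 that by (cases "n = k") auto
    then have "k \<le> k - 1" unfolding k_def by (intro Least_le) blast
    then show False using \<open>k \<noteq> 0\<close> by simp
  qed
  have no9: "\<exists>m\<le>n. f m \<noteq> 9" for n
  proof (rule ccontr)
    assume "\<nexists>m. m \<le> n \<and> f m \<noteq> 9"
    then have 9: "\<forall>m\<le>n. f m = 9" by blast
    define p where "p = nat \<bar>n\<bar>"
    have p: "- int p \<le> n" by (simp add: p_def)
    \<comment> \<open>appending a digit 9 multiplies the floor plus 1 by ten\<close>
    have grow: "F (- int (p + j)) + 1 = (F (- int p) + 1) * 10 ^ j" for j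
    proof (induction j)
      case (Suc j)
      have "f (- int (p + Suc j)) = 9" using 9 p by auto
      then show ?case using F_rec[of "- int (p + Suc j)"] Suc by simp
    qed simp
    have "real (F (- int p) + 1) \<le> u * 10 ^ p + 1 / 10 ^ j" for j
    proof -
      have "real (F (- int (p + j))) \<le> u * 10 ^ (p + j)"
        unfolding F_neg using u by (simp add: of_nat_nat)
      moreover have "real (F (- int (p + j))) + 1 = real (F (- int p) + 1) * 10 ^ j"
        using grow[of j] by (metis of_nat_1 of_nat_add of_nat_mult of_nat_numeral of_nat_power)
      ultimately show ?thesis by (simp add: field_simps power_add)
    qed
    moreover have "(\<lambda>j. u * 10 ^ p + 1 / 10 ^ j) \<longlonglongrightarrow> u * 10 ^ p + 0"
      by (intro tendsto_add tendsto_const ten_power_inverse_limit)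
    ultimately have "real (F (- int p) + 1) \<le> u * 10 ^ p"
      using LIMSEQ_le_const by fastforce
    moreover have "u * 10 ^ p < real (F (- int p) + 1)"
      unfolding F_neg using u by (simp add: of_nat_nat) linarith
    ultimately show False by linarith
  qed
  have nonzero: "\<exists>n. f n \<noteq> 0" if s
  proof (rule ccontr)
    assume "\<nexists>n. f n \<noteq> 0"
    then have f0: "f n = 0" for n by simp
    have "F (int k + 1 - int j) = 0" for j
    proof (induction j)
      case 0
      then show ?case using k[of "int k + 1"] by simp
    next
      case (Suc j)
      then show ?case using F_rec[of "int k + 1 - int (Suc j)"] f0 by (simp add: algebra_simps)
    qed
    from this[of "k + 1 + _"] have "F (- int m) = 0" for m by simp
    then have "u * 10 ^ m < 1" for m unfolding F_neg using u by (simp add: floor_less_iff zero_less_mult_iff less_eq_real_def)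
    then have "u \<le> 1 / 10 ^ m" for m by (simp add: field_simps less_imp_le)
    then have "u \<le> 0" using LIMSEQ_le_const[OF ten_power_inverse_limit] by blast
    then show False using s[OF that] by simp
  qed
  have f_above: "f n = 0" if "int k < n" for n using k[OF that] by (simp add: f_def)
  have f_le_9: "f n \<le> 9" for n
    using mod_less_divisor[of 10 "F n"] by (simp add: f_def)
  have "(s, k, f) \<in> {(s, k, f). (\<forall>n. f n \<le> 9) \<and> (\<forall>n. int k < n \<longrightarrow> f n = 0) \<and>
      (f (int k) = 0 \<longrightarrow> k = 0) \<and> \<not> (\<exists>n \<le> int k. \<forall>m \<le> n. f m = 9) \<and>
      \<not> (s \<and> k = 0 \<and> (\<forall>n. f n = 0))}"
    using f_above f_le_9 lead no9 nonzero by auto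
  then have Rep: "Rep_decimal (Abs_decimal (s, k, f)) = (s, k, f)"
    by (rule Abs_decimal_inverse)
  define d where "d = Abs_decimal (s, k, f)"
  have d: "neg d = s" "ord_dec d = k" "digit d = f"
    using Rep by (simp_all add: d_def neg_def ord_dec_def digit_def)
  have "mag d (int k + 1 - int j) = F (int k + 1 - int j)" for j
  proof (induction j)
    case 0
    then show ?case using k[of "int k + 1"] mag_above[of d "int k + 1"] d(2) by simp
  next
    case (Suc j)
    then show ?case
      using F_rec[of "int k + 1 - int (Suc j)"] mag_rec[of d "int k + 1 - int (Suc j)"] d(3)
      by (simp add: algebra_simps)
  qed
  from this[of "k + 1 + _"] have mag_F: "mag d (- int m) = F (- int m)" for m by simp
  have "\<bar>real (mag d (- int m)) / 10 ^ m - u\<bar> \<le> 1 / 10 ^ m" for m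
  proof -
    have "\<bar>real (F (- int m)) - u * 10 ^ m\<bar> \<le> 1"
      unfolding F_neg using u by (simp add: of_nat_nat) linarith
    then show ?thesis unfolding mag_F by (simp add: abs_le_iff field_simps)
  qed
  then have "(\<lambda>m. real (mag d (- int m)) / 10 ^ m - u) \<longlonglongrightarrow> 0"
    by (intro tendsto_0_le[OF ten_power_inverse_limit, of _ 1] always_eventually) auto
  then have "(\<lambda>m. real (mag d (- int m)) / 10 ^ m) \<longlonglongrightarrow> u"
    by (rule LIM_zero_cancel)
  then have "abs_val d = u" using abs_val_limit LIMSEQ_unique by blast
  then show ?thesis using d(1) by blast
qed

lemma bij_val: "bij val"
proof (rule bijI[OF inj_val], unfold surj_def, rule allI)
  fix x :: real
  obtain d where "neg d = (x < 0)" "abs_val d = \<bar>x\<bar>"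
    using ex_decimal_of_sign_and_modulus[of "\<bar>x\<bar>" "x < 0"] by auto
  then have "val d = x" by (simp add: val_def)
  then show "\<exists>d. x = val d" by blast
qed

lemma Q_D_add: "a \<in> Q_D \<Longrightarrow> b \<in> Q_D \<Longrightarrow> a + b \<in> Q_D"
proof -
  assume "a \<in> Q_D" "b \<in> Q_D"
  then obtain p m q n where ab: "a = of_int p / 10 ^ m" "b = of_int q / 10 ^ n"
    unfolding Q_D_def by blast
  then have "a + b = of_int (p * 10 ^ n + q * 10 ^ m) / 10 ^ (m + n)"
    unfolding ab by (simp add: add_divide_distrib power_add)
  then show "a + b \<in> Q_D" unfolding Q_D_def by blast
qed

lemma trunc_in_Q_D: "trunc d m \<in> Q_D"
proof -
  have "real_of_rat (trunc d m) =
      real_of_rat (of_int ((if neg d then - 1 else 1) * int (mag d (- int m))) / 10 ^ m)"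
    by (simp add: real_trunc of_rat_divide of_rat_power of_rat_minus)
  then have "trunc d m = of_int ((if neg d then - 1 else 1) * int (mag d (- int m))) / 10 ^ m"
    by (simp only: of_rat_eq_iff)
  then show ?thesis unfolding Q_D_def by blast
qed

lemma abs_less_one_over_iff: "\<bar>r\<bar> < 1 / of_nat k \<longleftrightarrow> \<bar>real_of_rat r\<bar> < 1 / real k"
proof -
  have "\<bar>r\<bar> < 1 / of_nat k \<longleftrightarrow> real_of_rat \<bar>r\<bar> < real_of_rat (1 / of_nat k)"
    by (simp only: of_rat_less)
  then show ?thesis by (simp add: of_rat_divide abs_if of_rat_minus)
qed

lemma LIMSEQ_iff_one_over:
  "X \<longlonglongrightarrow> (L :: real) \<longleftrightarrow> (\<forall>k\<ge>1. \<exists>n0\<ge>1. \<forall>n\<ge>n0. \<bar>X n - L\<bar> < 1 / real k)"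
proof
  assume X: "X \<longlonglongrightarrow> L"
  show "\<forall>k\<ge>1. \<exists>n0\<ge>1. \<forall>n\<ge>n0. \<bar>X n - L\<bar> < 1 / real k"
  proof (intro allI impI)
    fix k :: nat assume "1 \<le> k"
    then obtain n0 where "\<forall>n\<ge>n0. norm (X n - L) < 1 / real k"
      using LIMSEQ_D[OF X, of "1 / real k"] by auto
    then show "\<exists>n0\<ge>1. \<forall>n\<ge>n0. \<bar>X n - L\<bar> < 1 / real k"
      by (intro exI[of _ "max 1 n0"]) auto
  qed
next
  assume *: "\<forall>k\<ge>1. \<exists>n0\<ge>1. \<forall>n\<ge>n0. \<bar>X n - L\<bar> < 1 / real k"
  show "X \<longlonglongrightarrow> L"
  proof (rule LIMSEQ_I)
    fix r :: real assume "0 < r"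
    then obtain k where k: "1 / real (Suc k) < r" by (metis nat_approx_posE)
    obtain n0 where "\<forall>n\<ge>n0. \<bar>X n - L\<bar> < 1 / real (Suc k)"
      using *[rule_format, of "Suc k"] by auto
    then have "\<forall>n\<ge>n0. norm (X n - L) < r"
      using k unfolding real_norm_def by (metis less_trans)
    then show "\<exists>n0. \<forall>n\<ge>n0. norm (X n - L) < r" ..
  qed
qed

lemma Cauchy_iff_one_over:
  "Cauchy (X :: nat \<Rightarrow> real) \<longleftrightarrow>
    (\<forall>k\<ge>1. \<exists>n0\<ge>1. \<forall>m\<ge>n0. \<forall>n\<ge>n0. \<bar>X m - X n\<bar> < 1 / real k)"
proof
  assume X: "Cauchy X"
  show "\<forall>k\<ge>1. \<exists>n0\<ge>1. \<forall>m\<ge>n0. \<forall>n\<ge>n0. \<bar>X m - X n\<bar> < 1 / real k"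
  proof (intro allI impI)
    fix k :: nat assume "1 \<le> k"
    then obtain n0 where "\<forall>m\<ge>n0. \<forall>n\<ge>n0. norm (X m - X n) < 1 / real k"
      using CauchyD[OF X, of "1 / real k"] by auto
    then show "\<exists>n0\<ge>1. \<forall>m\<ge>n0. \<forall>n\<ge>n0. \<bar>X m - X n\<bar> < 1 / real k"
      by (intro exI[of _ "max 1 n0"]) auto
  qed
next
  assume *: "\<forall>k\<ge>1. \<exists>n0\<ge>1. \<forall>m\<ge>n0. \<forall>n\<ge>n0. \<bar>X m - X n\<bar> < 1 / real k"
  show "Cauchy X"
  proof (rule CauchyI)
    fix r :: real assume "0 < r"
    then obtain k where k: "1 / real (Suc k) < r" by (metis nat_approx_posE)
    obtain n0 where "\<forall>m\<ge>n0. \<forall>n\<ge>n0. \<bar>X m - X n\<bar> < 1 / real (Suc k)"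
      using *[rule_format, of "Suc k"] by auto
    then have "\<forall>m\<ge>n0. \<forall>n\<ge>n0. norm (X m - X n) < r"
      using k unfolding real_norm_def by (metis less_trans)
    then show "\<exists>n0. \<forall>m\<ge>n0. \<forall>n\<ge>n0. norm (X m - X n) < r" ..
  qed
qed

text \<open>Rational Cauchy sequences and their limits can thus be handled as convergent sequences of real
  numbers.\<close>

lemma generates_iff:
  "generates a d \<longleftrightarrow> (\<forall>n\<ge>1. a n \<in> Q_D) \<and> (\<lambda>n. real_of_rat (a n)) \<longlonglongrightarrow> val d"
proof -
  have cauchy: "cauchy_QD a \<longleftrightarrow> (\<forall>n\<ge>1. a n \<in> Q_D) \<and> Cauchy (\<lambda>n. real_of_rat (a n))"
    unfolding cauchy_QD_def abs_less_one_over_iff Cauchy_iff_one_over by (simp add: of_rat_diff)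
  have "(\<forall>k\<ge>1. \<exists>n0\<ge>1. \<forall>n\<ge>n0. \<bar>trunc d n - a n\<bar> < 1 / of_nat k) \<longleftrightarrow>
      (\<lambda>n. real_of_rat (trunc d n) - real_of_rat (a n)) \<longlonglongrightarrow> 0"
    unfolding abs_less_one_over_iff LIMSEQ_iff_one_over by (simp add: of_rat_diff)
  also have "\<dots> \<longleftrightarrow> (\<lambda>n. real_of_rat (a n)) \<longlonglongrightarrow> val d"
  proof
    assume "(\<lambda>n. real_of_rat (trunc d n) - real_of_rat (a n)) \<longlonglongrightarrow> 0"
    from tendsto_diff[OF val_limit[of d] this] show "(\<lambda>n. real_of_rat (a n)) \<longlonglongrightarrow> val d" by simp
  next
    assume "(\<lambda>n. real_of_rat (a n)) \<longlonglongrightarrow> val d"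
    from tendsto_diff[OF val_limit[of d] this]
    show "(\<lambda>n. real_of_rat (trunc d n) - real_of_rat (a n)) \<longlonglongrightarrow> 0" by simp
  qed
  finally show ?thesis
    unfolding generates_def cauchy using LIMSEQ_imp_Cauchy by blast
qed

lemma G_eq: "generates a d \<Longrightarrow> G a = d"
  unfolding G_def generates_iff
  by (rule the_equality) (auto dest: LIMSEQ_unique injD[OF inj_val])

lemma val_add_R: "val (d +\<^sub>R e) = val d + val e"
proof -
  obtain s where s: "val s = val d + val e"
    using bij_val by (metis bij_is_surj surjD)
  have sum: "G (\<lambda>n. a n + b n) = s" if "generates a d" "generates b e" for a b
    using that by (intro G_eq) (auto simp: generates_iff s of_rat_add intro: Q_D_add tendsto_add)
  have trunc: "generates (trunc c) c" for c
    by (simp add: generates_iff trunc_in_Q_D val_limit)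
  have "d +\<^sub>R e = s"
    unfolding add_R_def
    by (rule the_equality) (use sum trunc in \<open>metis\<close>)+
  then show ?thesis using s by simp
qed

lemma add_R_funpow: "val (((+\<^sub>R) d ^^ n) x) = real n * val d + val x"
  by (induction n) (simp_all add: val_add_R algebra_simps)

lemma bij_add_R: "bij ((+\<^sub>R) d)"
proof (rule bijI)
  show "inj ((+\<^sub>R) d)"
    by (rule injI) (metis add_left_cancel injD[OF inj_val] val_add_R)
  show "surj ((+\<^sub>R) d)"
  proof (unfold surj_def, rule allI)
    fix y
    obtain x where "val x = val y - val d"
      using bij_val by (metis bij_is_surj surjD)
    then have "y = d +\<^sub>R x" by (intro injD[OF inj_val]) (simp add: val_add_R)
    then show "\<exists>x. y = d +\<^sub>R x" ..
  qed
qed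

lemma infinite_range_frac_val:
  assumes "v \<noteq> 0"
  shows "infinite (range (\<lambda>x. frac (val x / v)))"
proof -
  have "{0..<1} \<subseteq> range (\<lambda>x. frac (val x / v))"
  proof
    fix r :: real assume "r \<in> {0..<1}"
    moreover obtain x where "val x = r * v"
      using bij_val by (metis bij_is_surj surjD)
    ultimately show "r \<in> range (\<lambda>x. frac (val x / v))"
      using assms by (intro range_eqI[of _ _ x]) (simp add: frac_eq)
  qed
  then show ?thesis
    by (meson finite_subset infinite_Ico zero_less_one)
qed

section \<open>Transducers on unary machines\<close>

text \<open>A letter-to-letter transducer is given by its transition function \<open>\<delta>\<close> and its output function
  \<open>out\<close>, both depending on the current state and letter; its initial state is 0. \<open>run\<close> is the
  state before the letter at position \<open>n\<close> is read.\<close>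

definition run :: "(nat \<Rightarrow> sym \<Rightarrow> nat) \<Rightarrow> word \<Rightarrow> nat \<Rightarrow> nat"
  where "run \<delta> w n = foldl \<delta> 0 (map w [0..<n])"

definition transduce :: "(nat \<Rightarrow> sym \<Rightarrow> nat) \<Rightarrow> (nat \<Rightarrow> sym \<Rightarrow> sym) \<Rightarrow> word \<Rightarrow> word"
  where "transduce \<delta> out w n = out (run \<delta> w n) (w n)"

lemma run_0 [simp]: "run \<delta> w 0 = 0"
  by (simp add: run_def)

lemma run_Suc [simp]: "run \<delta> w (Suc n) = \<delta> (run \<delta> w n) (w n)"
  by (simp add: run_def)

text \<open>While the transducer is in state \<open>q\<close> and the first head rests on the letter it is about to read,
  the machine is in one of four phases: \<open>dec\<close> decrements the counter by scanning it from the
  least significant digit; \<open>ret\<close> brings the second head back to cell 0 and then lets the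
  transducer read the letter; \<open>erase\<close> and \<open>emit\<close> clear the tape and write the output once the
  counter has run out. The terminal state is 0.\<close>

definition dec_state :: "nat \<Rightarrow> nat" where "dec_state q = 4 * q + 1"
definition ret_state :: "nat \<Rightarrow> nat" where "ret_state q = 4 * q + 2"
definition erase_state :: "nat \<Rightarrow> nat" where "erase_state q = 4 * q + 3"
definition emit_state :: "nat \<Rightarrow> nat" where "emit_state q = 4 * q + 4"

lemmas state_defs = dec_state_def ret_state_def erase_state_def emit_state_def

text \<open>Borrowing turns low-order 0s into 1s. A blank met while borrowing means that the counter was 0
  already; by then it consists of 1s only, which are about to be erased anyway.\<close>

definition counter_instr ::
    "(nat \<Rightarrow> sym \<Rightarrow> nat) \<Rightarrow> (nat \<Rightarrow> sym \<Rightarrow> sym) \<Rightarrow> nat \<Rightarrow> sym \<Rightarrow> sym \<Rightarrow> sym \<times> int \<times> int \<times> nat"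
  where "counter_instr \<delta> out s a b =
    (let q = (s - 1) div 4 in
     if s = dec_state q then
       (if b = Dig 1 then (Dig 0, 0, 0, ret_state q)
        else if b = Blank then (Blank, 0, - 1, erase_state q)
        else (Dig 1, 0, 1, dec_state q))
     else if s = ret_state q then
       (if b = Blank then (Blank, 1, 1, dec_state (\<delta> q a)) else (b, 0, - 1, ret_state q))
     else if s = erase_state q then
       (if b = Blank then (Blank, 0, 1, emit_state q) else (Blank, 0, - 1, erase_state q))
     else (out q a, 0, 0, 0))"

definition counter_machine ::
    "sym set \<Rightarrow> nat \<Rightarrow> (nat \<Rightarrow> sym \<Rightarrow> nat) \<Rightarrow> (nat \<Rightarrow> sym \<Rightarrow> sym) \<Rightarrow> machine"
  where "counter_machine A n \<delta> out =
    \<lparr>states = {..4 * n}, init = dec_state 0, final = 0,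
     tape_alph = A \<union> {Dig 0, Dig 1, Blank}, instr = counter_instr \<delta> out\<rparr>"

lemma counter_instr_simps [simp]:
  "counter_instr \<delta> out (dec_state q) a b =
     (if b = Dig 1 then (Dig 0, 0, 0, ret_state q)
      else if b = Blank then (Blank, 0, - 1, erase_state q)
      else (Dig 1, 0, 1, dec_state q))"
  "counter_instr \<delta> out (ret_state q) a b =
     (if b = Blank then (Blank, 1, 1, dec_state (\<delta> q a)) else (b, 0, - 1, ret_state q))"
  "counter_instr \<delta> out (erase_state q) a b =
     (if b = Blank then (Blank, 0, 1, emit_state q) else (Blank, 0, - 1, erase_state q))"
  "counter_instr \<delta> out (emit_state q) a b = (out q a, 0, 0, 0)"
  by (simp_all add: counter_instr_def state_defs Let_def)

lemma state_nonzero [simp]: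
  "dec_state q \<noteq> 0" "ret_state q \<noteq> 0" "erase_state q \<noteq> 0" "emit_state q \<noteq> 0"
  by (simp_all add: state_defs)

lemma state_cases:
  assumes "s \<in> {..4 * n} - {0}"
  obtains q where "q < n" "s = dec_state q \<or> s = ret_state q \<or> s = erase_state q \<or> s = emit_state q"
proof -
  have "(s - 1) div 4 < n" using assms by auto
  moreover have "s = dec_state ((s - 1) div 4) \<or> s = ret_state ((s - 1) div 4) \<or>
    s = erase_state ((s - 1) div 4) \<or> s = emit_state ((s - 1) div 4)"
    using assms by (simp add: state_defs) presburger
  ultimately show thesis by (rule that)
qed

lemma unary_machine_counter_machine:
  assumes "finite A" "Blank \<notin> A" "0 < n"
    and \<delta>: "\<And>q a. q < n \<Longrightarrow> \<delta> q a < n"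
    and out: "\<And>q a. q < n \<Longrightarrow> a \<in> A \<union> {Dig 0, Dig 1, Blank} \<Longrightarrow> out q a \<in> A \<union> {Dig 0, Dig 1, Blank}"
  shows "unary_machine A (counter_machine A n \<delta> out)"
proof -
  have "counter_instr \<delta> out s a b \<in>
      (A \<union> {Dig 0, Dig 1, Blank}) \<times> {-1, 0, 1} \<times> {-1, 0, 1} \<times> {..4 * n}"
    if s: "s \<in> {..4 * n} - {0}" and ab: "a \<in> A \<union> {Dig 0, Dig 1, Blank}" "b \<in> A \<union> {Dig 0, Dig 1, Blank}"
    for s a b
  proof -
    obtain q where q: "q < n"
        "s = dec_state q \<or> s = ret_state q \<or> s = erase_state q \<or> s = emit_state q"
      using s by (rule state_cases)
    have st: "dec_state p \<in> {..4 * n}" "ret_state p \<in> {..4 * n}" "erase_state p \<in> {..4 * n}"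
        "emit_state p \<in> {..4 * n}" if "p < n" for p
      using that by (simp_all add: state_defs)
    show ?thesis
      using q(2) st[OF q(1)] st(1)[OF \<delta>[OF q(1)], of a] out[OF q(1) ab(1)] ab(2)
      by (elim disjE) auto
  qed
  then show ?thesis
    using assms(1-3) unfolding unary_machine_def counter_machine_def
    by (simp add: dec_state_def)
qed

definition bits_tape :: "nat list \<Rightarrow> int \<Rightarrow> sym"
  where "bits_tape bs i = (if 0 \<le> i \<and> nat i < length bs then Dig (bs ! nat i) else Blank)"

definition bits_val :: "nat list \<Rightarrow> nat"
  where "bits_val bs = foldr (\<lambda>b s. b + 2 * s) bs 0"

lemma bits_val_simps [simp]: "bits_val [] = 0" "bits_val (b # bs) = b + 2 * bits_val bs"
  by (simp_all add: bits_val_def)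

lemma bits_val_bin_digits [simp]: "bits_val (bin_digits n) = n"
proof (induction n rule: bin_digits.induct)
  case (1 n)
  then show ?case by (subst bin_digits.simps) auto
qed

lemma bits_tape_upd:
  "(bits_tape (us @ b # vs))(int (length us) := Dig c) = bits_tape (us @ c # vs)"
  by (rule ext) (auto simp: bits_tape_def nth_append nth_Cons split: nat.splits)

lemma bits_tape_at [simp]: "bits_tape (us @ b # vs) (int (length us)) = Dig b"
  by (simp add: bits_tape_def)

lemma bits_tape_end [simp]: "bits_tape us (int (length us)) = Blank"
  by (simp add: bits_tape_def)

lemma bits_tape_neg [simp]: "bits_tape us (- 1) = Blank"
  by (simp add: bits_tape_def)

lemma bits_tape_snoc: "(bits_tape (us @ [b]))(int (length us) := Blank) = bits_tape us"
  by (rule ext) (auto simp: bits_tape_def nth_append)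

lemma bits_tape_Nil [simp]: "bits_tape [] = (\<lambda>_. Blank)"
  by (rule ext) (simp add: bits_tape_def)

lemma bits_tape_not_Blank:
  "0 \<le> i \<Longrightarrow> i < int (length bs) \<Longrightarrow> bits_tape bs i \<noteq> Blank"
  by (simp add: bits_tape_def nat_less_iff)

context
  fixes A :: "sym set" and n :: nat and \<delta> :: "nat \<Rightarrow> sym \<Rightarrow> nat"
    and out :: "nat \<Rightarrow> sym \<Rightarrow> sym" and x :: word
begin

definition reaches :: "config \<Rightarrow> config \<Rightarrow> bool"
  where "reaches c c' \<longleftrightarrow> (\<exists>t. (step (counter_machine A n \<delta> out) x ^^ t) c = c')"

lemma reaches_refl: "reaches c c"
  unfolding reaches_def by (rule exI[of _ 0]) simp

lemma reaches_step:
  assumes "step (counter_machine A n \<delta> out) x c = c1" "reaches c1 c2"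
  shows "reaches c c2"
proof -
  obtain t where "(step (counter_machine A n \<delta> out) x ^^ t) c1 = c2"
    using assms(2) by (auto simp: reaches_def)
  then have "(step (counter_machine A n \<delta> out) x ^^ Suc t) c = c2"
    using assms(1) by (simp add: funpow_swap1)
  then show ?thesis unfolding reaches_def by blast
qed

lemma reaches_trans:
  assumes "reaches c c1" "reaches c1 c2"
  shows "reaches c c2"
proof -
  obtain t u where "(step (counter_machine A n \<delta> out) x ^^ t) c = c1"
      "(step (counter_machine A n \<delta> out) x ^^ u) c1 = c2"
    using assms by (auto simp: reaches_def)
  then have "(step (counter_machine A n \<delta> out) x ^^ (u + t)) c = c2"
    by (simp add: funpow_add)
  then show ?thesis unfolding reaches_def by blast
qed

lemma step_counter [simp]:
  assumes "s \<noteq> 0"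
  shows "step (counter_machine A n \<delta> out) x \<lparr>state = s, head1 = i, head2 = j, tape2 = T\<rparr> =
    (case counter_instr \<delta> out s (tape1 x i) (T j) of
       (b, di, dj, q) \<Rightarrow> \<lparr>state = q, head1 = i + di, head2 = j + dj, tape2 = T(j := b)\<rparr>)"
  using assms by (simp add: step_def counter_machine_def)

text \<open>The list \<open>us\<close> holds the digits through which the borrow has already passed. The counter keeps
  its length, so it may acquire zeros at its most significant end.\<close>

lemma reaches_decrement:
  assumes "set bs \<subseteq> {0, 1}" "0 < bits_val bs"
  obtains bs' j where "set bs' \<subseteq> {0, 1}" "bits_val bs' + 1 = bits_val bs"
    "j < length (us @ bs')"
    "reaches \<lparr>state = dec_state q, head1 = i, head2 = int (length us), tape2 = bits_tape (us @ bs)\<rparr>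
       \<lparr>state = ret_state q, head1 = i, head2 = int j, tape2 = bits_tape (us @ bs')\<rparr>"
  using assms
proof (induction bs arbitrary: us thesis)
  case (Cons b bs)
  consider "b = 0" | "b = 1" using Cons.prems(2) by auto
  then show ?case
  proof cases
    case 1
    then have bs: "set bs \<subseteq> {0, 1}" "0 < bits_val bs" using Cons.prems(2,3) by auto
    obtain bs' j where IH: "set bs' \<subseteq> {0, 1}" "bits_val bs' + 1 = bits_val bs"
      "j < length ((us @ [1]) @ bs')"
      "reaches \<lparr>state = dec_state q, head1 = i, head2 = int (length (us @ [1])),
           tape2 = bits_tape ((us @ [1]) @ bs)\<rparr>
         \<lparr>state = ret_state q, head1 = i, head2 = int j, tape2 = bits_tape ((us @ [1]) @ bs')\<rparr>"
      by (rule Cons.IH[where us = "us @ [1]", OF _ bs])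
    show ?thesis
    proof (rule Cons.prems(1))
      show "set (1 # bs') \<subseteq> {0, 1}" "bits_val (1 # bs') + 1 = bits_val (b # bs)"
          "j < length (us @ 1 # bs')"
        using IH(1-3) 1 by auto
      show "reaches \<lparr>state = dec_state q, head1 = i, head2 = int (length us),
           tape2 = bits_tape (us @ b # bs)\<rparr>
         \<lparr>state = ret_state q, head1 = i, head2 = int j, tape2 = bits_tape (us @ 1 # bs')\<rparr>"
        by (rule reaches_step[OF _ IH(4)[unfolded append_assoc append.simps]]) (use 1 in \<open>simp add: bits_tape_upd\<close>)
    qed
  next
    case 2
    show ?thesis
    proof (rule Cons.prems(1))
      show "set (0 # bs) \<subseteq> {0, 1}" "bits_val (0 # bs) + 1 = bits_val (b # bs)"
          "length us < length (us @ 0 # bs)"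
        using Cons.prems(2) 2 by auto
      show "reaches \<lparr>state = dec_state q, head1 = i, head2 = int (length us),
           tape2 = bits_tape (us @ b # bs)\<rparr>
         \<lparr>state = ret_state q, head1 = i, head2 = int (length us), tape2 = bits_tape (us @ 0 # bs)\<rparr>"
        by (rule reaches_step[OF _ reaches_refl]) (use 2 in \<open>simp add: bits_tape_upd\<close>)
    qed
  qed
qed simp

lemma reaches_underflow:
  assumes "set bs \<subseteq> {0, 1}" "bits_val bs = 0"
  shows "\<exists>bs'. reaches
      \<lparr>state = dec_state q, head1 = i, head2 = int (length us), tape2 = bits_tape (us @ bs)\<rparr>
      \<lparr>state = erase_state q, head1 = i, head2 = int (length bs') - 1, tape2 = bits_tape bs'\<rparr>"
  using assms
proof (induction bs arbitrary: us)
  case Nil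
  have "reaches \<lparr>state = dec_state q, head1 = i, head2 = int (length us), tape2 = bits_tape us\<rparr>
      \<lparr>state = erase_state q, head1 = i, head2 = int (length us) - 1, tape2 = bits_tape us\<rparr>"
    by (rule reaches_step[OF _ reaches_refl]) (simp add: fun_upd_idem)
  then show ?case by auto
next
  case (Cons b bs)
  then obtain bs' where "reaches
      \<lparr>state = dec_state q, head1 = i, head2 = int (length (us @ [1])),
       tape2 = bits_tape ((us @ [1]) @ bs)\<rparr>
      \<lparr>state = erase_state q, head1 = i, head2 = int (length bs') - 1, tape2 = bits_tape bs'\<rparr>"
    using Cons.IH[of "us @ [1]"] by auto
  then have "reaches
      \<lparr>state = dec_state q, head1 = i, head2 = int (length us), tape2 = bits_tape (us @ b # bs)\<rparr>
      \<lparr>state = erase_state q, head1 = i, head2 = int (length bs') - 1, tape2 = bits_tape bs'\<rparr>"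
    by (rule reaches_step[rotated]) (use Cons.prems in \<open>simp add: bits_tape_upd\<close>)
  then show ?case by blast
qed

text \<open>The second head scans to the left until it meets the blank in cell \<open>- 1\<close>; starting it at
  \<open>j - 1\<close> covers the case that it is there already.\<close>

lemma reaches_return:
  assumes "j \<le> length bs"
  shows "reaches \<lparr>state = ret_state q, head1 = i, head2 = int j - 1, tape2 = bits_tape bs\<rparr>
    \<lparr>state = dec_state (\<delta> q (tape1 x i)), head1 = i + 1, head2 = 0, tape2 = bits_tape bs\<rparr>"
  using assms
proof (induction j)
  case 0
  show ?case
    by (rule reaches_step[OF _ reaches_refl]) (simp add: fun_upd_idem)
next
  case (Suc j)
  then have "bits_tape bs (int j) \<noteq> Blank" by (intro bits_tape_not_Blank) auto
  then show ?case
    using Suc by (intro reaches_step[OF _ Suc.IH]) (simp_all add: fun_upd_idem)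
qed

lemma reaches_erase:
  "reaches \<lparr>state = erase_state q, head1 = i, head2 = int (length bs) - 1, tape2 = bits_tape bs\<rparr>
    \<lparr>state = 0, head1 = i, head2 = 0, tape2 = (\<lambda>_. Blank)(0 := out q (tape1 x i))\<rparr>"
proof (induction bs rule: rev_induct)
  case Nil
  have "reaches \<lparr>state = emit_state q, head1 = i, head2 = 0, tape2 = \<lambda>_. Blank\<rparr>
    \<lparr>state = 0, head1 = i, head2 = 0, tape2 = (\<lambda>_. Blank)(0 := out q (tape1 x i))\<rparr>"
    by (rule reaches_step[OF _ reaches_refl]) simp
  then show ?case
    by (rule reaches_step[rotated]) (simp add: fun_upd_idem)
next
  case (snoc b bs)
  show ?case
    by (rule reaches_step[OF _ snoc]) (simp add: bits_tape_snoc)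
qed

text \<open>The invariant of the main loop: at the start of a round the first head is at the position
  \<open>k\<close> about to be read, and the counter holds the distance to the requested position.\<close>

lemma reaches_output:
  assumes "set bs \<subseteq> {0, 1}" "bits_val bs = v"
  shows "\<exists>i. reaches
      \<lparr>state = dec_state (run \<delta> x k), head1 = int k, head2 = 0, tape2 = bits_tape bs\<rparr>
      \<lparr>state = 0, head1 = i, head2 = 0, tape2 = (\<lambda>_. Blank)(0 := transduce \<delta> out x (k + v))\<rparr>"
  using assms
proof (induction v arbitrary: bs k)
  case 0
  have x: "tape1 x (int k) = x k" by (simp add: tape1_def)
  obtain bs' where "reaches
      \<lparr>state = dec_state (run \<delta> x k), head1 = int k, head2 = 0, tape2 = bits_tape bs\<rparr>
      \<lparr>state = erase_state (run \<delta> x k), head1 = int k, head2 = int (length bs') - 1,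
       tape2 = bits_tape bs'\<rparr>"
    using reaches_underflow[OF 0, of "run \<delta> x k" "int k" "[]"] by auto
  from reaches_trans[OF this reaches_erase] show ?case
    unfolding transduce_def x add_0_right by blast
next
  case (Suc v)
  have x: "tape1 x (int k) = x k" by (simp add: tape1_def)
  obtain bs' j where bs': "set bs' \<subseteq> {0, 1}" "bits_val bs' + 1 = bits_val bs"
    "j < length ([] @ bs')"
    "reaches
      \<lparr>state = dec_state (run \<delta> x k), head1 = int k, head2 = int (length ([]::nat list)), tape2 = bits_tape ([] @ bs)\<rparr>
      \<lparr>state = ret_state (run \<delta> x k), head1 = int k, head2 = int j, tape2 = bits_tape ([] @ bs')\<rparr>"
    using reaches_decrement[of bs "[]" "run \<delta> x k" "int k"] Suc.prems by auto
  have "reaches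
      \<lparr>state = ret_state (run \<delta> x k), head1 = int k, head2 = int j, tape2 = bits_tape bs'\<rparr>
      \<lparr>state = dec_state (run \<delta> x (Suc k)), head1 = int (Suc k), head2 = 0, tape2 = bits_tape bs'\<rparr>"
    using reaches_return[of "Suc j" bs' "run \<delta> x k" "int k"] bs'(3) x by (simp add: add.commute)
  moreover have "bits_val bs' = v" using bs'(2) Suc.prems(2) by simp
  ultimately obtain i where "reaches
      \<lparr>state = dec_state (run \<delta> x k), head1 = int k, head2 = 0, tape2 = bits_tape bs\<rparr>
      \<lparr>state = 0, head1 = i, head2 = 0, tape2 = (\<lambda>_. Blank)(0 := transduce \<delta> out x (Suc k + v))\<rparr>"
    using Suc.IH[OF bs'(1), of "Suc k"] bs'(4)[unfolded append.simps list.size of_nat_0]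
    by (meson reaches_trans)
  then show ?case unfolding add_Suc_shift by blast
qed

end

lemma computes_counter_machine: "computes (counter_machine A n \<delta> out) X (transduce \<delta> out)"
  unfolding computes_def
proof (intro ballI allI)
  fix x m
  have "set (bin_digits m) \<subseteq> {0, 1}"
    using bin_digits_le_1[of _ m] by (auto simp: le_Suc_eq)
  then obtain i where "reaches A n \<delta> out x
      \<lparr>state = dec_state (run \<delta> x 0), head1 = int 0, head2 = 0, tape2 = bits_tape (bin_digits m)\<rparr>
      \<lparr>state = 0, head1 = i, head2 = 0, tape2 = (\<lambda>_. Blank)(0 := transduce \<delta> out x (0 + m))\<rparr>"
    using reaches_output[of "bin_digits m" m A n \<delta> out x 0] by auto
  moreover have "\<lparr>state = dec_state (run \<delta> x 0), head1 = int 0, head2 = 0,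
      tape2 = bits_tape (bin_digits m)\<rparr> = start (counter_machine A n \<delta> out) m"
    by (simp add: start_def counter_machine_def bits_tape_def fun_eq_iff)
  ultimately obtain t where "(step (counter_machine A n \<delta> out) x ^^ t)
      (start (counter_machine A n \<delta> out) m) =
      \<lparr>state = 0, head1 = i, head2 = 0, tape2 = (\<lambda>_. Blank)(0 := transduce \<delta> out x (0 + m))\<rparr>"
    by (auto simp: reaches_def)
  then show "\<exists>t. state ((step (counter_machine A n \<delta> out) x ^^ t)
        (start (counter_machine A n \<delta> out) m)) = final (counter_machine A n \<delta> out) \<and>
      tape2 ((step (counter_machine A n \<delta> out) x ^^ t) (start (counter_machine A n \<delta> out) m)) =
        (\<lambda>_. Blank)(0 := transduce \<delta> out x m)"
    by (intro exI[of _ t]) (simp add: counter_machine_def)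
qed

section \<open>Digit strings\<close>

text \<open>The digit string of a decimal in the order in which it is encoded, leading digit first.\<close>

definition digits :: "decimal \<Rightarrow> nat \<Rightarrow> nat"
  where "digits d j = digit d (int (ord_dec d) - int j)"

text \<open>The digit strings of decimals of sign \<open>s\<close> and order \<open>k\<close>. For positive order the
  last condition follows from the leading digit being nonzero; for order 0 it excludes minus zero.\<close>

definition is_digits :: "bool \<Rightarrow> nat \<Rightarrow> (nat \<Rightarrow> nat) \<Rightarrow> bool"
  where "is_digits s k h \<longleftrightarrow> (\<forall>j. h j \<le> 9) \<and> (h 0 = 0 \<longrightarrow> k = 0) \<and> (\<forall>i. \<exists>j\<ge>i. h j \<noteq> 9) \<and>
    (s \<longrightarrow> (\<exists>j. h j \<noteq> 0))"

definition mk_decimal :: "bool \<Rightarrow> nat \<Rightarrow> (nat \<Rightarrow> nat) \<Rightarrow> decimal"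
  where "mk_decimal s k h = Abs_decimal (s, k, \<lambda>n. if n \<le> int k then h (nat (int k - n)) else 0)"

lemma digit_digits: "n \<le> int (ord_dec d) \<Longrightarrow> digit d n = digits d (nat (int (ord_dec d) - n))"
  by (simp add: digits_def)

lemma is_digits_digits: "is_digits (neg d) (ord_dec d) (digits d)"
  unfolding is_digits_def
proof (intro conjI allI impI)
  show "digits d j \<le> 9" for j by (simp add: digits_def digit_le_9)
  show "ord_dec d = 0" if "digits d 0 = 0"
    using that Rep_decimal[of d] by (auto simp: digits_def digit_def ord_dec_def split: prod.splits)
  show "\<exists>j\<ge>i. digits d j \<noteq> 9" for i
  proof -
    obtain m where m: "m \<le> int (ord_dec d) - int i" "digit d m \<noteq> 9" using no_tail_of_9 by blast
    then show ?thesis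
      using digit_digits[of m d] by (intro exI[of _ "nat (int (ord_dec d) - m)"]) auto
  qed
  show "\<exists>j. digits d j \<noteq> 0" if "neg d"
  proof -
    obtain n where n: "digit d n \<noteq> 0" using not_neg_zero[OF \<open>neg d\<close>] by blast
    then have "n \<le> int (ord_dec d)" using digit_above_order[of d n] by (cases "n \<le> int (ord_dec d)") auto
    then show ?thesis using n digit_digits[of n d] by auto
  qed
qed

lemma mk_decimal:
  assumes "is_digits s k h"
  shows "neg (mk_decimal s k h) = s" "ord_dec (mk_decimal s k h) = k" "digits (mk_decimal s k h) = h"
proof -
  define f where "f n = (if n \<le> int k then h (nat (int k - n)) else 0)" for n
  have fh: "f (int k - int j) = h j" for j by (simp add: f_def)
  have no9: "\<exists>m\<le>n. f m \<noteq> 9" if "n \<le> int k" for n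
  proof -
    obtain j where "j \<ge> nat (int k - n)" "h j \<noteq> 9" using assms by (auto simp: is_digits_def)
    then show ?thesis using that by (intro exI[of _ "int k - int j"]) (auto simp: fh)
  qed
  have nz: "\<exists>n. f n \<noteq> 0" if sign: s
  proof -
    obtain j where "h j \<noteq> 0" using assms sign by (auto simp: is_digits_def)
    then show ?thesis by (intro exI[of _ "int k - int j"]) (simp add: fh)
  qed
  have "(s, k, f) \<in> {(s, k, f). (\<forall>n. f n \<le> 9) \<and> (\<forall>n. int k < n \<longrightarrow> f n = 0) \<and>
      (f (int k) = 0 \<longrightarrow> k = 0) \<and> \<not> (\<exists>n \<le> int k. \<forall>m \<le> n. f m = 9) \<and>
      \<not> (s \<and> k = 0 \<and> (\<forall>n. f n = 0))}"
    using assms no9 nz by (auto simp: is_digits_def f_def)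
  then have Rep: "Rep_decimal (mk_decimal s k h) = (s, k, f)"
    unfolding mk_decimal_def f_def[abs_def] by (rule Abs_decimal_inverse)
  then show "neg (mk_decimal s k h) = s" "ord_dec (mk_decimal s k h) = k"
      "digits (mk_decimal s k h) = h"
    by (auto simp: neg_def ord_dec_def digits_def digit_def fh)
qed

lemma decimal_eqI_digits:
  assumes "neg d = neg e" "ord_dec d = ord_dec e" "digits d = digits e"
  shows "d = e"
proof -
  have "digit d n = digit e n" for n
    using assms(2,3) digit_digits[of n d] digit_digits[of n e]
      digit_above_order[of d n] digit_above_order[of e n]
    by (cases "n \<le> int (ord_dec d)") auto
  then show ?thesis using assms by (intro decimal_eqI) auto
qed

section \<open>The adding machine\<close>

text \<open>The carry starts just after the position \<open>p\<close> and passes through digits equal to \<open>a\<close>; \<open>in_run a p h j\<close>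
  says that it reaches the digit at \<open>j\<close>.\<close>

definition in_run :: "nat \<Rightarrow> nat \<Rightarrow> (nat \<Rightarrow> nat) \<Rightarrow> nat \<Rightarrow> bool"
  where "in_run a p h j \<longleftrightarrow> p < j \<and> (\<forall>i. p < i \<and> i < j \<longrightarrow> h i = a)"

text \<open>The two parameters treat the adding machine (\<open>a = 0\<close>, \<open>c = 1\<close>) and its inverse (\<open>a = 1\<close>, \<open>c = 9\<close>)
  at the same time.\<close>

definition carry :: "nat \<Rightarrow> nat \<Rightarrow> nat \<Rightarrow> (nat \<Rightarrow> nat) \<Rightarrow> nat \<Rightarrow> nat"
  where "carry a c p h j = (if in_run a p h j then (h j + c) mod 10 else h j)"

lemma in_run_0 [simp]: "\<not> in_run a p h 0"
  by (simp add: in_run_def)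

lemma in_run_Suc: "in_run a p h (Suc j) \<longleftrightarrow> p = j \<or> in_run a p h j \<and> h j = a"
  unfolding in_run_def by (auto simp: less_Suc_eq)

lemma mod_10_add_complement: "c \<le> 10 \<Longrightarrow> ((x + c) mod 10 + (10 - c)) mod 10 = x mod (10 :: nat)"
  unfolding mod_add_left_eq by simp

text \<open>Adding \<open>c\<close> modulo 10 is injective on digits, so the digits through which the carry passes can be
  recognised afterwards as the run of digits \<open>a + c\<close>. This makes the carry reversible.\<close>

lemma in_run_carry:
  assumes h: "\<And>j. h j \<le> 9" and a: "a \<le> 9" and c: "c \<le> 10"
  shows "in_run ((a + c) mod 10) p (carry a c p h) j \<longleftrightarrow> in_run a p h j"
proof (induction j)
  case (Suc j)
  have "h j mod 10 = h j" "a mod 10 = a"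
    using h[of j] a by simp_all
  then have "(h j + c) mod 10 = (a + c) mod 10 \<longleftrightarrow> h j = a"
    by (metis mod_10_add_complement[OF c])
  then show ?case using Suc by (auto simp: in_run_Suc carry_def)
qed simp

lemma carry_carry:
  assumes h: "\<And>j. h j \<le> 9" and a: "a \<le> 9" and c: "c \<le> 10"
  shows "carry ((a + c) mod 10) (10 - c) p (carry a c p h) = h"
proof
  fix j
  have "((h j + c) mod 10 + (10 - c)) mod 10 = h j"
    using h[of j] mod_10_add_complement[OF c] by simp
  then show "carry ((a + c) mod 10) (10 - c) p (carry a c p h) j = h j"
    using in_run_carry[of h a c p j, OF h a c]
    by (cases "in_run a p h j") (simp_all only: carry_def if_True if_False)
qed

lemma carry_below: "j \<le> p \<Longrightarrow> carry a c p h j = h j"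
  by (simp add: carry_def in_run_def)

text \<open>Either the carry stops and the tail is unchanged, or it never stops and the new tail is constant
  with digit \<open>a + c\<close>.\<close>

lemma carry_tail:
  assumes "\<And>i. \<exists>j\<ge>i. h j \<noteq> 9" and "(a + c) mod 10 \<noteq> 9"
  shows "\<exists>j\<ge>i. carry a c p h j \<noteq> 9"
proof (cases "\<exists>l>p. h l \<noteq> a")
  case True
  then obtain l where l: "p < l" "h l \<noteq> a" by blast
  obtain j where "j \<ge> max i (Suc l)" "h j \<noteq> 9" using assms(1) by blast
  moreover from this l have "\<not> in_run a p h j" by (auto simp: in_run_def)
  ultimately show ?thesis by (intro exI[of _ j]) (simp add: carry_def)
next
  case False
  then have "carry a c p h (max i (Suc p)) = (a + c) mod 10"
    by (auto simp: carry_def in_run_def)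
  then show ?thesis using assms(2) by (intro exI[of _ "max i (Suc p)"]) simp
qed

text \<open>The last position that the adding machine leaves alone. In negative decimals it protects a nonzero
  digit, so that minus zero is not produced.\<close>

definition pivot :: "bool \<Rightarrow> (nat \<Rightarrow> nat) \<Rightarrow> nat"
  where "pivot s h = (if s then LEAST j. h j \<noteq> 0 else 0)"

lemma pivot_nonzero: "is_digits True k h \<Longrightarrow> h (pivot True h) \<noteq> 0"
  unfolding pivot_def is_digits_def by (auto intro: LeastI)

lemma below_pivot: "j < pivot True h \<Longrightarrow> h j = 0"
  unfolding pivot_def using not_less_Least[of j "\<lambda>j. h j \<noteq> 0"] by auto

lemma pivot_carry:
  assumes "is_digits s k h"
  shows "pivot s (carry a c (pivot s h) h) = pivot s h"
proof (cases s)
  case True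
  have "(LEAST j. carry a c (pivot s h) h j \<noteq> 0) = pivot s h"
  proof (rule Least_equality)
    show "carry a c (pivot s h) h (pivot s h) \<noteq> 0"
      using pivot_nonzero[of k h] assms True by (simp add: carry_below)
    show "pivot s h \<le> j" if "carry a c (pivot s h) h j \<noteq> 0" for j
    proof (rule ccontr)
      assume "\<not> pivot s h \<le> j"
      then have "h j = 0" using True by (intro below_pivot) auto
      then show False using that \<open>\<not> pivot s h \<le> j\<close> by (simp add: carry_below)
    qed
  qed
  then show ?thesis using True by (simp add: pivot_def)
qed (simp add: pivot_def)

lemma is_digits_carry:
  assumes "is_digits s k h" "(a + c) mod 10 \<noteq> 9"
  shows "is_digits s k (carry a c (pivot s h) h)"
  unfolding is_digits_def
proof (intro conjI allI impI)
  show "carry a c (pivot s h) h j \<le> 9" for j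
    using assms(1) mod_less_divisor[of 10 "h j + c"] by (auto simp: is_digits_def carry_def)
  show "k = 0" if "carry a c (pivot s h) h 0 = 0"
    using assms(1) that by (simp add: is_digits_def carry_below)
  show "\<exists>j\<ge>i. carry a c (pivot s h) h j \<noteq> 9" for i
    using assms by (intro carry_tail) (auto simp: is_digits_def)
  show "\<exists>j. carry a c (pivot s h) h j \<noteq> 0" if s
    using assms(1) that pivot_nonzero[of k h]
    by (intro exI[of _ "pivot s h"]) (simp add: carry_below)
qed

definition turn :: "nat \<Rightarrow> nat \<Rightarrow> decimal \<Rightarrow> decimal"
  where "turn a c d = mk_decimal (neg d) (ord_dec d) (carry a c (pivot (neg d) (digits d)) (digits d))"

lemma turn_simps:
  assumes "(a + c) mod 10 \<noteq> 9"
  shows "neg (turn a c d) = neg d" "ord_dec (turn a c d) = ord_dec d"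
    "digits (turn a c d) = carry a c (pivot (neg d) (digits d)) (digits d)"
  unfolding turn_def by (simp_all add: mk_decimal is_digits_carry[OF is_digits_digits assms])

lemma digits_le_9: "digits d j \<le> 9"
  by (simp add: digits_def digit_le_9)

lemma turn_turn:
  assumes "a < 9" "c \<le> 10" "(a + c) mod 10 \<noteq> 9"
  shows "turn ((a + c) mod 10) (10 - c) (turn a c d) = d"
proof (rule decimal_eqI_digits)
  have ok: "((a + c) mod 10 + (10 - c)) mod 10 \<noteq> 9"
    using assms mod_10_add_complement[of c a] by simp
  note simps = turn_simps[OF assms(3)] turn_simps[OF ok]
  show "neg (turn ((a + c) mod 10) (10 - c) (turn a c d)) = neg d"
    "ord_dec (turn ((a + c) mod 10) (10 - c) (turn a c d)) = ord_dec d"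
    by (simp_all add: simps)
  show "digits (turn ((a + c) mod 10) (10 - c) (turn a c d)) = digits d"
    unfolding simps pivot_carry[OF is_digits_digits]
    by (rule carry_carry[OF digits_le_9 less_imp_le[OF assms(1)] assms(2)])
qed

definition odometer :: "decimal \<Rightarrow> decimal"
  where "odometer = turn 0 1"

lemma odometer_simps:
  "neg (odometer d) = neg d" "ord_dec (odometer d) = ord_dec d"
  "digits (odometer d) = carry 0 1 (pivot (neg d) (digits d)) (digits d)"
  unfolding odometer_def by (rule turn_simps, simp)+

lemma bij_odometer: "bij odometer"
  unfolding odometer_def
proof (rule o_bij[of "turn 1 9"])
  have "turn 1 9 (turn 0 1 d) = d" "turn 0 1 (turn 1 9 d) = d" for d
    using turn_turn[of 0 1 d] turn_turn[of 1 9 d] by simp_all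
  then show "turn 1 9 \<circ> turn 0 1 = id" "turn 0 1 \<circ> turn 1 9 = id"
    by (simp_all only: fun_eq_iff o_apply id_apply simp_thms)
qed

text \<open>The digits after \<open>p\<close> read as a number in base 10, least significant digit first, where the digit 0
  counts as 9 and every other digit counts as its predecessor. In this reading the digit that passes on the carry
  is the largest one, as in ordinary addition.\<close>

definition reading :: "nat \<Rightarrow> nat \<Rightarrow> (nat \<Rightarrow> nat) \<Rightarrow> nat"
  where "reading n p h = (\<Sum>i<n. ((h (p + 1 + i) + 9) mod 10) * 10 ^ i)"

lemma reading_carry:
  assumes "\<And>j. h j \<le> 9"
  shows "reading n p (carry 0 1 p h) + (if in_run 0 p h (p + 1 + n) then 10 ^ n else 0) =
    reading n p h + 1"
proof (induction n)
  case 0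
  then show ?case by (simp add: reading_def in_run_Suc)
next
  case (Suc n)
  define j where "j = p + 1 + n"
  have j: "p + 1 + Suc n = Suc j" "p \<noteq> j" by (simp_all add: j_def)
  have rec: "reading (Suc n) p g = reading n p g + ((g j + 9) mod 10) * 10 ^ n" for g
    by (simp add: reading_def j_def)
  consider "\<not> in_run 0 p h j" | "in_run 0 p h j" "h j = 0" | x where "in_run 0 p h j" "h j = Suc x" "x \<le> 8"
    using assms[of j] by (cases "h j") auto
  then show ?case
  proof cases
    case 1
    then have "carry 0 1 p h j = h j" by (simp add: carry_def)
    then show ?thesis using 1 Suc unfolding rec j(1) j_def[symmetric]
      by (simp add: in_run_Suc j(2))
  next
    case 2
    then have "carry 0 1 p h j = 1" by (simp add: carry_def)
    then show ?thesis using 2 Suc unfolding rec j(1) j_def[symmetric]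
      by (simp add: in_run_Suc j(2))
  next
    case 3
    have "(carry 0 1 p h j + 9) mod 10 = Suc x"
      using 3 mod_10_add_complement[of 1 "Suc x"] by (simp add: carry_def)
    moreover have "(h j + 9) mod 10 = x" using 3 by simp
    ultimately show ?thesis using 3 Suc unfolding rec j(1) j_def[symmetric]
      by (simp add: in_run_Suc j(2))
  qed
qed

text \<open>After \<open>t\<close> steps the reading has increased by \<open>t\<close> modulo every power of 10, in particular modulo
  \<open>10 ^ t > t\<close>.\<close>

lemma free_odometer: "free_map odometer"
  unfolding free_map_def
proof (intro allI impI notI)
  fix t :: nat and d assume "0 < t" and periodic: "(odometer ^^ t) d = d"
  define R where "R n d = reading n (pivot (neg d) (digits d)) (digits d)" for n d
  have step: "R n (odometer d) mod 10 ^ n = (R n d + 1) mod 10 ^ n" for n d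
  proof -
    have "R n (odometer d) = reading n (pivot (neg d) (digits d))
        (carry 0 1 (pivot (neg d) (digits d)) (digits d))"
      unfolding R_def odometer_simps pivot_carry[OF is_digits_digits] ..
    then obtain x where "R n (odometer d) + x = R n d + 1" "x = 10 ^ n \<or> x = 0"
      using reading_carry[of "digits d" n "pivot (neg d) (digits d)", OF digits_le_9]
      unfolding R_def by (auto split: if_splits)
    then show ?thesis by (metis add_0_right mod_add_self2)
  qed
  have "R n ((odometer ^^ m) d) mod 10 ^ n = (R n d + m) mod 10 ^ n" for n m
  proof (induction m)
    case (Suc m)
    have "R n ((odometer ^^ Suc m) d) mod 10 ^ n = (R n ((odometer ^^ m) d) mod 10 ^ n + 1) mod 10 ^ n"
      by (simp add: step mod_Suc_eq)
    then show ?case by (simp add: Suc mod_Suc_eq)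
  qed simp
  from this[of t t] periodic have "(R t d + t) mod 10 ^ t = R t d mod 10 ^ t" by simp
  then have "10 ^ t dvd t" by (subst (asm) mod_eq_dvd_iff_nat) auto
  then have "10 ^ t \<le> t" using \<open>0 < t\<close> by (rule dvd_imp_le)
  moreover have "t < 10 ^ t" by (rule power_gt_expt) simp
  ultimately show False by simp
qed

lemma infinite_range_ord_dec: "infinite (range ord_dec)"
proof -
  have "k \<in> range ord_dec" for k
  proof -
    have "is_digits False k (\<lambda>j. if j = 0 then 1 else 0)"
      unfolding is_digits_def by (auto intro: exI[of _ "Suc _"])
    then show ?thesis using mk_decimal(2) by (metis rangeI)
  qed
  then have "range ord_dec = UNIV" by auto
  then show ?thesis by simp
qed

section \<open>The adding machine as a transducer\<close>

fun successor_digit :: "sym \<Rightarrow> sym"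
  where "successor_digit (Dig n) = Dig ((n + 1) mod 10)"
  | "successor_digit a = a"

text \<open>The states: 0 and 1, inside the prefix, no sign or a minus sign seen; 2, at the leading digit of a
  decimal without sign; 3, at or before the first nonzero digit of a negative decimal; 4, the carry has
  reached the current digit; 5, the carry has stopped.\<close>

definition odo_next :: "nat \<Rightarrow> sym \<Rightarrow> nat"
  where "odo_next q a =
    (if q = 0 then (if a = Minus then 1 else if a = Sep then 2 else 0)
     else if q = 1 then (if a = Sep then 3 else 1)
     else if q = 2 then 4
     else if q = 3 then (if a = Dig 0 then 3 else 4)
     else if q = 4 then (if a = Dig 0 then 4 else 5)
     else 5)"

definition odo_out :: "nat \<Rightarrow> sym \<Rightarrow> sym"
  where "odo_out q a = (if q = 4 then successor_digit a else a)"

lemma odo_next_simps [simp]: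
  "odo_next 0 a = (if a = Minus then 1 else if a = Sep then 2 else 0)"
  "odo_next 1 a = (if a = Sep then 3 else 1)"
  "odo_next (Suc 0) a = (if a = Sep then 3 else 1)"
  "odo_next 2 a = 4"
  "odo_next 3 a = (if a = Dig 0 then 3 else 4)"
  "odo_next 4 a = (if a = Dig 0 then 4 else 5)"
  "odo_next 5 a = 5"
  by (simp_all add: odo_next_def)

lemma run_prefix:
  assumes "i \<le> length (enc_prefix d)"
  shows "run \<delta> (enc d) i = foldl \<delta> 0 (take i (enc_prefix d))"
proof -
  have "map (enc d) [0..<i] = take i (enc_prefix d)"
    by (rule nth_equalityI) (use assms in \<open>auto simp: enc_less\<close>)
  then show ?thesis by (simp add: run_def)
qed

lemma foldl_odo_next_digits: "q \<le> 1 \<Longrightarrow> foldl odo_next q (map Dig bs) = q"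
  by (induction bs) (auto simp: le_Suc_eq)

lemma run_odo_prefix:
  "i < length (enc_prefix d) \<Longrightarrow> run odo_next (enc d) i \<le> 1"
  "run odo_next (enc d) (length (enc_prefix d)) = (if neg d then 3 else 2)"
proof -
  show "run odo_next (enc d) i \<le> 1" if "i < length (enc_prefix d)"
  proof -
    have run: "run odo_next (enc d) i = foldl odo_next 0 (take i (enc_prefix d))"
      using that by (intro run_prefix) simp
    show ?thesis
    proof (cases "neg d")
      case True
      then show ?thesis
        unfolding run using that foldl_odo_next_digits[of 1 "take (i - 1) (bin_digits (ord_dec d))"]
        by (cases i) (auto simp: enc_prefix_def take_map)
    next
      case False
      then show ?thesis
        unfolding run using that foldl_odo_next_digits[of 0 "take i (bin_digits (ord_dec d))"]
        by (auto simp: enc_prefix_def take_map)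
    qed
  qed
  show "run odo_next (enc d) (length (enc_prefix d)) = (if neg d then 3 else 2)"
    using foldl_odo_next_digits[of 0] foldl_odo_next_digits[of 1]
    by (simp add: run_prefix) (simp add: enc_prefix_def)
qed

lemma run_odo_digits:
  "run odo_next (enc d) (length (enc_prefix d) + j) =
    (if j \<le> pivot (neg d) (digits d) then if neg d then 3 else 2
     else if in_run 0 (pivot (neg d) (digits d)) (digits d) j then 4 else 5)"
proof (induction j)
  case 0
  then show ?case by (simp add: run_odo_prefix(2))
next
  case (Suc j)
  define p where "p = pivot (neg d) (digits d)"
  have sym: "enc d (length (enc_prefix d) + j) = Dig (digits d j)"
    by (simp add: enc_prefix_plus digits_def)
  have run: "run odo_next (enc d) (length (enc_prefix d) + Suc j) =
      odo_next (run odo_next (enc d) (length (enc_prefix d) + j)) (Dig (digits d j))"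
    by (simp add: sym)
  have zero: "neg d \<Longrightarrow> j < p \<Longrightarrow> digits d j = 0"
    by (simp add: below_pivot p_def)
  have nonzero: "neg d \<Longrightarrow> digits d p \<noteq> 0"
    using pivot_nonzero[of "ord_dec d" "digits d"] is_digits_digits[of d] by (simp add: p_def)
  have pos: "\<not> neg d \<Longrightarrow> p = 0" by (simp add: pivot_def p_def)
  consider "j < p" | "j = p" | "p < j" by linarith
  then show ?case
    unfolding run Suc p_def[symmetric]
    using zero nonzero pos by cases (auto simp: in_run_Suc)
qed

lemma enc_odometer: "enc (odometer d) = transduce odo_next odo_out (enc d)"
proof
  fix i
  have pre: "enc_prefix (odometer d) = enc_prefix d"
    by (simp add: enc_prefix_def odometer_simps)
  show "enc (odometer d) i = transduce odo_next odo_out (enc d) i"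
  proof (cases "i < length (enc_prefix d)")
    case True
    then show ?thesis
      using run_odo_prefix(1)[OF True] by (simp add: enc_less pre transduce_def odo_out_def)
  next
    case False
    then obtain j where i: "i = length (enc_prefix d) + j"
      using le_Suc_ex not_less by blast
    have sym: "enc d i = Dig (digits d j)"
      by (simp add: i enc_prefix_plus digits_def)
    have "enc (odometer d) i = Dig (digits (odometer d) j)"
      using enc_prefix_plus[of "odometer d" j] by (simp add: i pre digits_def)
    then show ?thesis
      unfolding transduce_def sym unfolding i run_odo_digits
      by (auto simp: odometer_simps odo_out_def carry_def in_run_def)
  qed
qed

section \<open>The conjugated shift\<close>

lemma computable_transduce:
  assumes F: "F \<in> X_R \<rightarrow> X_R" "\<And>x. x \<in> X_R \<Longrightarrow> F x = transduce \<delta> out x"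
    and n: "0 < n" "\<And>q a. q < n \<Longrightarrow> \<delta> q a < n"
    and out: "\<And>q a. q < n \<Longrightarrow> a \<in> A_R \<union> {Blank} \<Longrightarrow> out q a \<in> A_R \<union> {Blank}"
  shows "computable A_R X_R F"
  unfolding computable_def
proof (intro conjI exI)
  have A: "A_R \<union> {Dig 0, Dig 1, Blank} = A_R \<union> {Blank}" by (auto simp: A_R_def)
  show "unary_machine A_R (counter_machine A_R n \<delta> out)"
  proof (rule unary_machine_counter_machine)
    show "finite A_R" "Blank \<notin> A_R" by (auto simp: A_R_def)
    show "out q a \<in> A_R \<union> {Dig 0, Dig 1, Blank}"
      if "q < n" "a \<in> A_R \<union> {Dig 0, Dig 1, Blank}" for q a
      using out that unfolding A by blast
  qed (fact n)+
  show "computes (counter_machine A_R n \<delta> out) X_R F"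
    using computes_counter_machine[of A_R n \<delta> out X_R] F(2) by (simp add: computes_def)
qed (use encoding_X_R F in auto)

text \<open>A permutation \<open>\<pi>\<close> of decimals acts on their codes, and conjugating by this action commutes with
  encoding.\<close>

lemma conjugate_enc:
  assumes "bij \<pi>"
  shows "bij_betw (enc \<circ> \<pi> \<circ> inv enc) X_R X_R"
    and "conjugate X_R (enc \<circ> \<pi> \<circ> inv enc) (add_shift d) (enc (\<pi> y)) = enc (\<pi> (d +\<^sub>R y))"
proof -
  have enc: "bij_betw enc UNIV X_R" by (simp add: X_R_def bij_betw_def inj_enc)
  have inv_enc: "bij_betw (inv enc) X_R UNIV" using bij_betw_inv_into[OF enc] .
  show bij: "bij_betw (enc \<circ> \<pi> \<circ> inv enc) X_R X_R"
    using bij_betw_trans[OF inv_enc bij_betw_trans[OF assms enc]] by (simp add: comp_assoc)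
  have "enc y \<in> X_R" by (simp add: X_R_def)
  moreover have "enc (\<pi> y) = (enc \<circ> \<pi> \<circ> inv enc) (enc y)" by (simp add: inj_enc)
  ultimately have "inv_into X_R (enc \<circ> \<pi> \<circ> inv enc) (enc (\<pi> y)) = enc y"
    using inv_into_f_f[OF bij_betw_imp_inj_on[OF bij]] by simp
  then show "conjugate X_R (enc \<circ> \<pi> \<circ> inv enc) (add_shift d) (enc (\<pi> y)) = enc (\<pi> (d +\<^sub>R y))"
    by (simp add: conjugate_def add_shift_def inj_enc)
qed

lemma conjugated_shift_computable:
  assumes \<pi>: "bij \<pi>" "\<And>y. \<pi> (d +\<^sub>R y) = g (\<pi> y)"
    and g: "\<And>y. enc (g y) = transduce \<delta> out (enc y)"
    and n: "0 < n" "\<And>q a. q < n \<Longrightarrow> \<delta> q a < n"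
    and out: "\<And>q a. q < n \<Longrightarrow> a \<in> A_R \<union> {Blank} \<Longrightarrow> out q a \<in> A_R \<union> {Blank}"
  shows "\<exists>\<pi>. bij_betw \<pi> X_R X_R \<and> computable A_R X_R (conjugate X_R \<pi> (add_shift d))"
proof (intro exI conjI)
  show "bij_betw (enc \<circ> \<pi> \<circ> inv enc) X_R X_R" using \<pi>(1) by (rule conjugate_enc)
  have "conjugate X_R (enc \<circ> \<pi> \<circ> inv enc) (add_shift d) x \<in> X_R \<and>
      conjugate X_R (enc \<circ> \<pi> \<circ> inv enc) (add_shift d) x = transduce \<delta> out x"
    if x: "x \<in> X_R" for x
  proof -
    obtain z where "x = enc z" using x unfolding X_R_def by blast
    moreover obtain y where "z = \<pi> y" using bij_is_surj[OF \<pi>(1)] by (rule surjE)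
    ultimately have "x = enc (\<pi> y)" by simp
    then show ?thesis
      using conjugate_enc(2)[OF \<pi>(1), of d y] by (simp add: \<pi>(2) g[symmetric] X_R_def)
  qed
  then show "computable A_R X_R (conjugate X_R (enc \<circ> \<pi> \<circ> inv enc) (add_shift d))"
    by (intro computable_transduce[where n = n and \<delta> = \<delta> and out = out, OF _ _ n out] Pi_I) blast+
qed

theorem theorem5p2:
  fixes d :: decimal
  shows "\<exists>\<pi>. bij_betw \<pi> X_R X_R \<and> computable A_R X_R (conjugate X_R \<pi> (add_shift d))"
proof (cases "val d = 0")
  case True
  then have zero: "d +\<^sub>R y = y" for y
    by (intro injD[OF inj_val]) (simp add: val_add_R)
  show ?thesis
  proof (rule conjugated_shift_computable)
    show "bij (id :: decimal \<Rightarrow> decimal)" by simp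
    show "id (d +\<^sub>R y) = id (id y)" for y by (simp add: zero)
    show "enc (id y) = transduce (\<lambda>_ _. 0) (\<lambda>_ a. a) (enc y)" for y
      by (simp add: transduce_def fun_eq_iff)
  qed (rule zero_less_one, auto)
next
  case False
  have free: "free_map ((+\<^sub>R) d)"
    unfolding free_map_def
  proof (intro allI impI notI)
    fix n :: nat and x assume "0 < n" "((+\<^sub>R) d ^^ n) x = x"
    then show False using add_R_funpow[of n d x] False by simp
  qed
  have inv: "frac (val (d +\<^sub>R x) / val d) = frac (val x / val d)" for x
  proof -
    have "val (d +\<^sub>R x) / val d = val x / val d + 1"
      using False by (simp add: val_add_R add_divide_distrib)
    then show ?thesis by (simp add: frac_1_eq)
  qed
  have ord: "ord_dec (odometer x) = ord_dec x" for x
    by (rule odometer_simps)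
  obtain \<pi> where \<pi>: "bij \<pi>" "\<And>y. \<pi> (d +\<^sub>R y) = odometer (\<pi> y)"
    using free_permutations_conjugate[OF bij_add_R free inv infinite_range_frac_val[OF False]
      bij_odometer free_odometer ord infinite_range_ord_dec] by metis
  show ?thesis
  proof (rule conjugated_shift_computable[OF \<pi> enc_odometer])
    show "(0::nat) < 6" by simp
    show "odo_next q a < 6" for q a by (simp add: odo_next_def)
    show "odo_out q a \<in> A_R \<union> {Blank}" if "a \<in> A_R \<union> {Blank}" for q a
      using that by (auto simp: odo_out_def A_R_def)
  qed
qed

end
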